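(* Let $f\in\mathbb{C}[x]$ be a polynomial of degree $d$ with set of critical values $\Sigma$, let $b\in\mathbb{C}\setminus\Sigma$ be a regular value, and let $\mathsf{S}_1,\dots,\mathsf{S}_m$ be the orbits of the monodromy group of $f$ on the set of simple cycles of $L_b=f^{-1}(b)$. Let $\omega\in\mathbb{C}[x]$ with $n=\deg\omega$, let $\mathcal{D}\subset\mathbb{C}\setminus\Sigma$ be any simply connected set with $b\in\mathcal{D}$, and let $\gamma(t)$, $t\in\mathcal{D}$, be a continuous family of simple cycles with $\gamma(b)\in\mathsf{S}_i$. If the Abelian integral $I(t)=\int_{\gamma(t)}\omega$ does not vanish identically, then the number of its complex zeros in $\mathcal{D}$ is bounded by $\deg(R_{\omega,i})$, and $$\deg(R_{\omega,i})\le\frac{(n-1)(d-1)}{2}.$$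
   Context: Put $L_t=f^{-1}(t)$. A simple cycle in $L_t$ is a formal difference $x_k-x_l$ of two distinct points of $L_t$. A continuous family of simple cycles on $\mathcal{D}$ is $\gamma(t)=x_k(t)-x_l(t)$ with $x_k,x_l$ continuous on $\mathcal{D}$, $f(x_k(t))=f(x_l(t))=t$, and $x_k(t)\neq x_l(t)$. One sets $\int_{x_k-x_l}\omega=\omega(x_k)-\omega(x_l)$; in particular $\int_{x_k-x_l}x=x_k-x_l$. The fundamental group $\pi_1(\mathbb{C}\setminus\Sigma,b)$ acts on $L_b$ by continuation of roots of $f(x)=t$ along loops; the monodromy group $G$ is the image of this action in the group of permutations of $L_b$. $G$ acts on the set $\mathsf{S}=\{x_k-x_l: x_k\ne x_l\in L_b\}$ of simple cycles, and $\mathsf{S}=\mathsf{S}_1\cup\dots\cup\mathsf{S}_m$ is the partition of $\mathsf{S}$ into $G$-orbits. For each $i$ define, for $t$ near $b$, $$R_{\omega,i}(t)=\prod_{\gamma\in\mathsf{S}_i/\pm1}\frac{\int_{\gamma}\omega}{\int_{\gamma}x},$$ where each $\gamma\in\mathsf{S}_i$ is continued from $L_b$ to $L_t$ as a continuous family, and $\mathsf{S}_i/\pm1$ means that two cycles $\gamma,-\gamma$ which both lie in $\mathsf{S}_i$ contribute a single factor (each factor is unchanged under $\gamma\mapsto-\gamma$). The function $R_{\omega,i}$ extends to a single-valued function on $\mathbb{C}\setminus\Sigma$, which is a polynomial in $t$; $\deg(R_{\omega,i})$ is its degree. *)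

theory Defs
  imports "HOL-Analysis.Analysis" "HOL-Computational_Algebra.Polynomial"
begin

definition critical_values :: "complex poly \<Rightarrow> complex set" where
  "critical_values f = {poly f c | c. poly (pderiv f) c = 0}"

definition fiber :: "complex poly \<Rightarrow> complex \<Rightarrow> complex set" where
  "fiber f t = {x. poly f x = t}"

text \<open>A simple cycle, the formal difference of two distinct points of a fibre, is encoded
  as the ordered pair of these points; its negative is the swapped pair.\<close>

type_synonym cycle = "complex \<times> complex"

definition simple_cycles :: "complex poly \<Rightarrow> complex \<Rightarrow> cycle set" where
  "simple_cycles f t = {(x, y). x \<in> fiber f t \<and> y \<in> fiber f t \<and> x \<noteq> y}"

definition cycle_integral :: "complex poly \<Rightarrow> cycle \<Rightarrow> complex" where
  "cycle_integral \<omega> \<gamma> = poly \<omega> (fst \<gamma>) - poly \<omega> (snd \<gamma>)"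

definition simple_cycle_family ::
    "complex poly \<Rightarrow> complex set \<Rightarrow> (complex \<Rightarrow> cycle) \<Rightarrow> bool" where
  "simple_cycle_family f D \<gamma> \<longleftrightarrow>
     continuous_on D (\<lambda>t. fst (\<gamma> t)) \<and> continuous_on D (\<lambda>t. snd (\<gamma> t)) \<and>
     (\<forall>t\<in>D. \<gamma> t \<in> simple_cycles f t)"

text \<open>Continuing the root \<open>x\<close> of the equation \<open>f = p 0\<close> along the path \<open>p\<close> leads to the root \<open>y\<close>
  of \<open>f = p 1\<close>.\<close>

definition continues_to ::
    "complex poly \<Rightarrow> (real \<Rightarrow> complex) \<Rightarrow> complex \<Rightarrow> complex \<Rightarrow> bool" where
  "continues_to f p x y \<longleftrightarrow>
     (\<exists>q. path q \<and> pathstart q = x \<and> pathfinish q = y \<and> (\<forall>s\<in>{0..1}. poly f (q s) = p s))"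

text \<open>The endpoint of a continuation depends only on the homotopy class of the loop, so the set of
  permutations induced by all loops is the image of the fundamental group. Elements are
  permutations of the fibre extended by the identity.\<close>

definition monodromy_group :: "complex poly \<Rightarrow> complex \<Rightarrow> (complex \<Rightarrow> complex) set" where
  "monodromy_group f b =
     {\<sigma>. \<sigma> permutes fiber f b \<and>
        (\<exists>p. path p \<and> path_image p \<subseteq> - critical_values f \<and> pathstart p = b \<and> pathfinish p = b \<and>
             (\<forall>x\<in>fiber f b. continues_to f p x (\<sigma> x)))}"

definition cycle_orbit :: "complex poly \<Rightarrow> complex \<Rightarrow> cycle \<Rightarrow> cycle set" where
  "cycle_orbit f b \<gamma> = {map_prod \<sigma> \<sigma> \<gamma> | \<sigma>. \<sigma> \<in> monodromy_group f b}"

definition cycle_orbits :: "complex poly \<Rightarrow> complex \<Rightarrow> cycle set set" where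
  "cycle_orbits f b = cycle_orbit f b ` simple_cycles f b"

text \<open>For \<open>t\<close> in a disc around \<open>b\<close> free of critical values, the continuous branch of roots
  through \<open>x\<close> is the continuation along segments issuing from \<open>b\<close>.\<close>

definition root_branch :: "complex poly \<Rightarrow> complex \<Rightarrow> complex \<Rightarrow> complex \<Rightarrow> complex" where
  "root_branch f b t x = (THE y. continues_to f (linepath b t) x y)"

definition cycle_branch :: "complex poly \<Rightarrow> complex \<Rightarrow> complex \<Rightarrow> cycle \<Rightarrow> cycle" where
  "cycle_branch f b t = map_prod (root_branch f b t) (root_branch f b t)"

definition cycle_sign_rel :: "(cycle \<times> cycle) set" where
  "cycle_sign_rel = {(\<gamma>, \<delta>). \<delta> = \<gamma> \<or> \<delta> = prod.swap \<gamma>}"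

definition cycle_quotient :: "complex poly \<Rightarrow> cycle \<Rightarrow> complex" where
  "cycle_quotient \<omega> \<gamma> = cycle_integral \<omega> \<gamma> / cycle_integral [:0, 1:] \<gamma>"

lemma cycle_quotient_swap: "cycle_quotient \<omega> (prod.swap \<gamma>) = cycle_quotient \<omega> \<gamma>"
  unfolding cycle_quotient_def cycle_integral_def
  by (simp flip: minus_divide_divide[of "poly \<omega> (fst \<gamma>) - poly \<omega> (snd \<gamma>)"])

text \<open>Each class of the quotient by sign contributes one factor; the choice of its representative
  is immaterial by \<open>cycle_quotient_swap\<close>. The value is meaningful for \<open>t\<close> near \<open>b\<close>.\<close>

definition orbit_product ::
    "complex poly \<Rightarrow> complex \<Rightarrow> complex poly \<Rightarrow> cycle set \<Rightarrow> complex \<Rightarrow> complex" where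
  "orbit_product f b \<omega> S t =
     (\<Prod>c \<in> S // cycle_sign_rel. cycle_quotient \<omega> (cycle_branch f b t (SOME \<gamma>. \<gamma> \<in> c)))"

definition orbit_poly ::
    "complex poly \<Rightarrow> complex \<Rightarrow> complex poly \<Rightarrow> cycle set \<Rightarrow> complex poly" where
  "orbit_poly f b \<omega> S =
     (THE R. \<forall>\<^sub>F t in nhds b. poly R t = orbit_product f b \<omega> S t)"

lemma orbit_poly_eqI:
  assumes "\<forall>\<^sub>F t in nhds b. poly R t = orbit_product f b \<omega> S t"
  shows "orbit_poly f b \<omega> S = R"
  unfolding orbit_poly_def
proof (rule the_equality)
  show "\<forall>\<^sub>F t in nhds b. poly R t = orbit_product f b \<omega> S t" by (fact assms)
next
  fix Q assume "\<forall>\<^sub>F t in nhds b. poly Q t = orbit_product f b \<omega> S t"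
  with assms have "\<forall>\<^sub>F t in nhds b. poly (Q - R) t = 0"
    by eventually_elim simp
  then obtain U where U: "open U" "b \<in> U" "U \<subseteq> {t. poly (Q - R) t = 0}"
    unfolding eventually_nhds by auto
  have "infinite U"
    using U(1,2) finite_imp_not_open by blast
  then have "Q - R = 0"
    using U(3) poly_roots_finite finite_subset by blast
  then show "Q = R" by simp
qed

end

theory Submission
  imports Defs "HOL-Complex_Analysis.Complex_Analysis"
    "HOL-Computational_Algebra.Fundamental_Theorem_Algebra"
begin

text \<open>The pairs \<open>(x, y)\<close> with \<open>f x = f y\<close> regular and \<open>x \<noteq> y\<close> form a curve covering the regular
  values, and by path lifting the monodromy orbits of simple cycles are the fibres over \<open>b\<close> of its
  path components. For such a component, the product of the quotients over the fibre at \<open>t\<close> is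
  therefore a single-valued holomorphic function \<open>R\<close> of the regular value \<open>t\<close>. The roots of
  \<open>f = t\<close> are \<open>O(t powr (1 / d))\<close> and each quotient is \<open>O(t powr ((n - 1) / d))\<close>, so \<open>R\<close> extends
  over the critical values and, by Liouville, is a polynomial of degree at most
  \<open>(n - 1) / d * (d * (d - 1) / 2)\<close>. A zero of the integral on \<open>D\<close> makes a factor of \<open>R\<close> vanish.
  If \<open>R\<close> were zero, one factor would vanish near \<open>b\<close>, and by the identity theorem the integral would
  vanish on the whole component, hence along \<open>\<gamma>\<close>.\<close>

subsection \<open>Growth of polynomials and regular fibres\<close>

lemma norm_poly_le:
  fixes p :: "'a :: real_normed_field poly"
  obtains C where "C \<ge> 0" "\<And>x. norm (poly p x) \<le> C * (1 + norm x) ^ degree p"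
proof
  show "(\<Sum>i\<le>degree p. norm (coeff p i)) \<ge> 0"
    by (simp add: sum_nonneg)
  fix x
  have "norm (poly p x) \<le> (\<Sum>i\<le>degree p. norm (coeff p i) * norm x ^ i)"
    unfolding poly_altdef by (rule order_trans[OF norm_sum]) (simp add: norm_mult norm_power)
  also have "\<dots> \<le> (\<Sum>i\<le>degree p. norm (coeff p i) * (1 + norm x) ^ degree p)"
  proof (intro sum_mono mult_left_mono)
    fix i assume "i \<in> {..degree p}"
    have "norm x ^ i \<le> (1 + norm x) ^ i" by (simp add: power_mono)
    also have "\<dots> \<le> (1 + norm x) ^ degree p"
      using \<open>i \<in> _\<close> by (intro power_increasing) auto
    finally show "norm x ^ i \<le> (1 + norm x) ^ degree p" .
  qed auto
  finally show "norm (poly p x) \<le> (\<Sum>i\<le>degree p. norm (coeff p i)) * (1 + norm x) ^ degree p"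
    by (simp add: sum_distrib_right)
qed

text \<open>Outside a large disc the leading term dominates; inside it the constant absorbs
  everything. Applied to \<open>f\<close>, this bounds the roots of \<open>f = t\<close>; applied to
  a polynomial of known growth, it bounds the degree.\<close>

lemma power_degree_le_norm_poly:
  fixes p :: "'a :: real_normed_field poly"
  assumes "p \<noteq> 0"
  obtains C where "C > 0" "\<And>x. (1 + norm x) ^ degree p \<le> C * (1 + norm (poly p x))"
proof (cases "degree p")
  case 0
  show ?thesis by (rule that[of 1]) (auto simp: 0)
next
  case (Suc k)
  define l where "l = norm (lead_coeff p)"
  have l: "l > 0" using assms by (simp add: l_def)
  \<comment> \<open>Beyond \<open>M0\<close> the lower terms amount to at most half of the leading
    one, so the other half is bounded by the value of \<open>p\<close>.\<close>
  obtain M0 where M0: "\<And>z. M0 \<le> norm z \<Longrightarrow>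
      norm (\<Sum>i\<le>k. coeff p i * z ^ i) \<le> l / 2 * norm z ^ Suc k"
    using polyfun_extremal_lemma[of "l / 2" "coeff p" k] l by auto
  define M where "M = max 1 M0"
  define C where "C = (1 + M) ^ degree p + 2 ^ degree p * 2 / l"
  have C: "C \<ge> (1 + M) ^ degree p" "C \<ge> 2 ^ degree p * 2 / l" "C > 0"
    using l by (auto simp: C_def M_def intro!: add_pos_pos)
  have "(1 + norm x) ^ degree p \<le> C * (1 + norm (poly p x))" for x
  proof (cases "norm x \<le> M")
    case True
    have "(1 + norm x) ^ degree p \<le> (1 + M) ^ degree p"
      using True by (intro power_mono) auto
    also have "\<dots> \<le> C * 1" using C by simp
    also have "\<dots> \<le> C * (1 + norm (poly p x))"
      using C by (intro mult_left_mono) auto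
    finally show ?thesis .
  next
    case False
    have eq: "poly p x = (\<Sum>i\<le>k. coeff p i * x ^ i) + lead_coeff p * x ^ Suc k"
      by (simp add: poly_altdef Suc)
    have "l * norm x ^ Suc k = norm (lead_coeff p * x ^ Suc k)"
      by (simp only: l_def norm_mult norm_power)
    also have "\<dots> \<le> norm (poly p x) + norm (\<Sum>i\<le>k. coeff p i * x ^ i)"
      unfolding eq by (metis add.commute add_diff_cancel_right' norm_triangle_ineq4)
    also have "\<dots> \<le> norm (poly p x) + l / 2 * norm x ^ Suc k"
      using M0[of x] False by (simp add: M_def)
    finally have *: "norm x ^ degree p \<le> 2 / l * norm (poly p x)"
      using l unfolding Suc by (simp add: field_simps)
    have "(1 + norm x) ^ degree p \<le> (2 * norm x) ^ degree p"
      using False by (intro power_mono) (auto simp: M_def)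
    also have "\<dots> \<le> 2 ^ degree p * (2 / l * norm (poly p x))"
      unfolding power_mult_distrib using * by (intro mult_left_mono) auto
    also have "\<dots> = (2 ^ degree p * 2 / l) * norm (poly p x)"
      by simp
    also have "\<dots> \<le> C * norm (poly p x)"
      using C by (intro mult_right_mono) auto
    also have "\<dots> \<le> C * (1 + norm (poly p x))"
      using C by (intro mult_left_mono) auto
    finally show ?thesis .
  qed
  with C show ?thesis using that by blast
qed

lemma degree_le_of_norm_poly_le:
  fixes p :: "complex poly"
  assumes "\<And>t. A \<le> norm t \<Longrightarrow> norm (poly p t) \<le> C * (1 + norm t) ^ m"
  shows "degree p \<le> m"
proof (rule ccontr)
  assume "\<not> degree p \<le> m"
  then have deg: "Suc m \<le> degree p" and "p \<noteq> 0" by auto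
  then obtain C' where C': "C' > 0" "\<And>x. (1 + norm x) ^ degree p \<le> C' * (1 + norm (poly p x))"
    using power_degree_le_norm_poly by blast
  \<comment> \<open>A single real point gives the contradiction: it lies in the region of the growth
    hypothesis and is at least the total constant \<open>C' * (1 + \<bar>C\<bar>)\<close>, so that
    \<open>1 + s\<close> would be at most \<open>s\<close>.\<close>
  define s where "s = \<bar>A\<bar> + C' * (1 + \<bar>C\<bar>)"
  have s: "s \<ge> 0" "s \<ge> A" "s \<ge> C' * (1 + \<bar>C\<bar>)"
    using C'(1) by (auto simp: s_def intro: add_increasing2)
  have "(1 + s) * (1 + s) ^ m \<le> (1 + s) ^ degree p"
    using power_increasing[OF deg, of "1 + s"] s by simp
  also have "\<dots> \<le> C' * (1 + norm (poly p (of_real s)))"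
    using C'(2)[of "of_real s"] s by simp
  also have "\<dots> \<le> C' * (1 + C * (1 + s) ^ m)"
    using assms[of "of_real s"] s C'(1) by (intro mult_left_mono add_left_mono) auto
  also have "\<dots> \<le> C' * ((1 + s) ^ m + \<bar>C\<bar> * (1 + s) ^ m)"
    using s C'(1) by (intro mult_left_mono add_mono mult_right_mono one_le_power) auto
  also have "\<dots> = (C' * (1 + \<bar>C\<bar>)) * (1 + s) ^ m"
    by (simp add: algebra_simps)
  also have "\<dots> \<le> s * (1 + s) ^ m"
    using s by (intro mult_right_mono) auto
  finally show False
    using s by (simp add: mult_le_cancel_right)
qed

text \<open>Mean value inequality on the disc of radius \<open>M\<close>. The derivative has degree
  one less, which is the source of the exponent \<open>n - 1\<close> in the final bound.\<close>

lemma norm_poly_diff_le: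
  fixes p :: "complex poly"
  obtains C where "C \<ge> 1"
    "\<And>M x y. norm x \<le> M \<Longrightarrow> norm y \<le> M \<Longrightarrow>
       norm (poly p x - poly p y) \<le> C * (1 + M) ^ (degree p - 1) * norm (x - y)"
proof -
  obtain C where C: "C \<ge> 0" "\<And>x. norm (poly (pderiv p) x) \<le> C * (1 + norm x) ^ degree (pderiv p)"
    using norm_poly_le by blast
  show ?thesis
  proof (rule that[of "max 1 C"])
    fix M and x y :: complex assume xy: "norm x \<le> M" "norm y \<le> M"
    show "norm (poly p x - poly p y) \<le> max 1 C * (1 + M) ^ (degree p - 1) * norm (x - y)"
    proof (rule field_differentiable_bound[of "cball 0 M" _ "poly (pderiv p)"])
      fix z :: complex assume z: "z \<in> cball 0 M"
      have "norm (poly (pderiv p) z) \<le> C * (1 + norm z) ^ (degree p - 1)"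
        using C(2)[of z] by (simp add: degree_pderiv)
      also have "\<dots> \<le> max 1 C * (1 + M) ^ (degree p - 1)"
        using z by (intro mult_mono power_mono) auto
      finally show "norm (poly (pderiv p) z) \<le> max 1 C * (1 + M) ^ (degree p - 1)" .
    qed (use xy in \<open>auto intro!: DERIV_subset[OF poly_DERIV]\<close>)
  qed auto
qed

lemma entire_poly_of_growth:
  assumes "g holomorphic_on UNIV"
    and "\<And>z. A \<le> norm z \<Longrightarrow> norm (g z) \<le> B * (1 + norm z) ^ m"
  obtains p where "\<And>z. g z = poly p z"
proof
  fix z
  have "g z = (\<Sum>k\<le>m. (deriv ^^ k) g 0 / fact k * z ^ k)"
  proof (rule Liouville_polynomial[OF assms(1)])
    \<comment> \<open>For \<open>norm z\<close> at least 1, the factor \<open>1 + norm z\<close> is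
      at most \<open>2 * norm z\<close>, at the cost of \<open>2 ^ m\<close> in the
      constant.\<close>
    fix z :: complex assume z: "max A 1 \<le> norm z"
    have "norm (g z) \<le> \<bar>B\<bar> * (1 + norm z) ^ m"
      using z by (intro order_trans[OF assms(2)] mult_right_mono) auto
    also have "\<dots> \<le> \<bar>B\<bar> * (2 * norm z) ^ m"
      using z by (intro mult_left_mono power_mono) auto
    finally show "norm (g z) \<le> (\<bar>B\<bar> * 2 ^ m) * norm z ^ m"
      by (simp add: power_mult_distrib mult.assoc)
  qed
  then show "g z = poly (\<Sum>k\<le>m. monom ((deriv ^^ k) g 0 / fact k) k) z"
    by (simp add: poly_sum poly_monom)
qed

lemma fiber_finite:
  assumes "degree f > 0"
  shows "finite (fiber f t)"
proof -
  have "fiber f t = {x. poly (f - [:t:]) x = 0}" by (auto simp: fiber_def)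
  moreover have "f - [:t:] \<noteq> 0" using assms by auto
  ultimately show ?thesis using poly_roots_finite by metis
qed

lemma card_fiber_le:
  assumes "degree f > 0"
  shows "card (fiber f t) \<le> degree f"
proof -
  have "fiber f t = {x. poly (f - [:t:]) x = 0}" by (auto simp: fiber_def)
  moreover have "f - [:t:] \<noteq> 0" using assms by auto
  moreover have "degree (f - [:t:]) \<le> degree f"
    by (rule degree_diff_le) auto
  ultimately show ?thesis using card_poly_roots_bound[of "f - [:t:]"] by simp
qed

text \<open>A multiple root of \<open>f - t\<close> would be a critical point with value
  \<open>t\<close>. For regular \<open>t\<close> the polynomial therefore splits into distinct
  linear factors.\<close>

lemma card_fiber:
  assumes "degree f > 0" "t \<notin> critical_values f"
  shows "card (fiber f t) = degree f"
proof -
  define g where "g = f - [:t:]"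
  have "g = f + [:-t:]" by (simp add: g_def)
  then have "degree g = degree f"
    using assms(1) by (simp add: degree_add_eq_left)
  then have g: "fiber f t = {x. poly g x = 0}" "g \<noteq> 0" "degree g = degree f"
    using assms(1) by (auto simp: g_def fiber_def)
  have "rsquarefree g"
    using assms(2) unfolding rsquarefree_roots
    by (auto simp: g_def critical_values_def pderiv_diff pderiv_pCons)
  then have "smult (lead_coeff g) (\<Prod>z|poly g z = 0. [:-z, 1:]) = g"
    by (rule complex_poly_decompose_rsquarefree)
  then have "degree g = degree (\<Prod>z|poly g z = 0. [:-z, 1:])"
    using g(2) by (metis degree_smult_eq leading_coeff_0_iff)
  also have "\<dots> = (\<Sum>z|poly g z = 0. degree [:-z, 1:])"
    by (rule degree_prod_eq_sum_degree) auto
  finally show ?thesis using g by simp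
qed

lemma finite_critical_values:
  assumes "degree f > 0"
  shows "finite (critical_values f)"
proof -
  have "pderiv f \<noteq> 0" using assms by (simp add: pderiv_eq_0_iff)
  then have "finite {c. poly (pderiv f) c = 0}" by (rule poly_roots_finite)
  moreover have "critical_values f = poly f ` {c. poly (pderiv f) c = 0}"
    by (auto simp: critical_values_def)
  ultimately show ?thesis by simp
qed

lemma open_regular_values:
  assumes "degree f > 0"
  shows "open (- critical_values f)"
  using finite_critical_values[OF assms] by (intro open_Compl finite_imp_closed)

subsection \<open>Local branches of the roots\<close>

text \<open>A holomorphic trivialisation of the covering over a disc, with each sheet indexed by its
  root over the centre. Bijectivity says at once that the sheets are disjoint and that they exhaust
  every fibre.\<close>

definition root_branches ::
    "complex poly \<Rightarrow> complex \<Rightarrow> real \<Rightarrow> (complex \<Rightarrow> complex \<Rightarrow> complex) \<Rightarrow> bool" where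
  "root_branches f t0 r g \<longleftrightarrow>
     r > 0 \<and> ball t0 r \<subseteq> - critical_values f \<and>
     (\<forall>a\<in>fiber f t0. g a holomorphic_on ball t0 r \<and> g a t0 = a) \<and>
     (\<forall>t\<in>ball t0 r. bij_betw (\<lambda>a. g a t) (fiber f t0) (fiber f t))"

lemma root_branchesD:
  assumes "root_branches f t0 r g"
  shows "r > 0" "t0 \<in> ball t0 r" "ball t0 r \<subseteq> - critical_values f"
    and "\<And>a. a \<in> fiber f t0 \<Longrightarrow> g a holomorphic_on ball t0 r"
    and "\<And>a. a \<in> fiber f t0 \<Longrightarrow> continuous_on (ball t0 r) (g a)"
    and "\<And>a. a \<in> fiber f t0 \<Longrightarrow> g a t0 = a"
    and "\<And>t. t \<in> ball t0 r \<Longrightarrow> bij_betw (\<lambda>a. g a t) (fiber f t0) (fiber f t)"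
    and "\<And>t. t \<in> ball t0 r \<Longrightarrow> inj_on (\<lambda>a. g a t) (fiber f t0)"
    and "\<And>t a. t \<in> ball t0 r \<Longrightarrow> a \<in> fiber f t0 \<Longrightarrow> g a t \<in> fiber f t"
    and "\<And>t a. t \<in> ball t0 r \<Longrightarrow> a \<in> fiber f t0 \<Longrightarrow> poly f (g a t) = t"
proof -
  show bij: "bij_betw (\<lambda>a. g a t) (fiber f t0) (fiber f t)" if "t \<in> ball t0 r" for t
    using assms that by (simp add: root_branches_def)
  show "inj_on (\<lambda>a. g a t) (fiber f t0)" if "t \<in> ball t0 r" for t
    using bij[OF that] by (rule bij_betw_imp_inj_on)
  show *: "g a t \<in> fiber f t" if "t \<in> ball t0 r" "a \<in> fiber f t0" for t a
    using bij_betwE[OF bij[OF that(1)]] that(2) by blast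
  show "poly f (g a t) = t" if "t \<in> ball t0 r" "a \<in> fiber f t0" for t a
    using *[OF that] by (simp add: fiber_def)
  show "g a holomorphic_on ball t0 r" if "a \<in> fiber f t0" for a
    using assms that by (simp add: root_branches_def)
  then show "continuous_on (ball t0 r) (g a)" if "a \<in> fiber f t0" for a
    using that holomorphic_on_imp_continuous_on by blast
qed (use assms in \<open>auto simp: root_branches_def\<close>)

text \<open>The local inverse is confined to a prescribed ball around \<open>a\<close>, so that
  branches through different roots can be kept apart.\<close>

lemma locally_biholomorphic:
  assumes "poly (pderiv f) a \<noteq> 0" "e > 0"
  obtains \<rho> g where "\<rho> > 0" "g holomorphic_on ball (poly f a) \<rho>"
    "g (poly f a) = a" "\<And>t. t \<in> ball (poly f a) \<rho> \<Longrightarrow> g t \<in> ball a e \<and> poly f (g t) = t"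
proof -
  have hol: "poly f holomorphic_on ball a e" by (intro holomorphic_intros)
  have "deriv (poly f) a \<noteq> 0"
    using assms by (simp add: DERIV_imp_deriv[OF poly_DERIV])
  then obtain s where s: "s > 0" "ball a s \<subseteq> ball a e" "open (poly f ` ball a s)"
      "inj_on (poly f) (ball a s)"
    using has_complex_derivative_locally_invertible[OF hol, of a] assms by auto
  obtain g where g: "g holomorphic_on (poly f ` ball a s)" "\<And>z. z \<in> ball a s \<Longrightarrow> g (poly f z) = z"
    using holomorphic_has_inverse[OF holomorphic_on_subset[OF hol s(2)] open_ball s(4)] by metis
  have "poly f a \<in> poly f ` ball a s" using s(1) by auto
  then obtain \<rho> where \<rho>: "\<rho> > 0" "ball (poly f a) \<rho> \<subseteq> poly f ` ball a s"
    using openE[OF s(3)] by metis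
  show ?thesis
  proof (rule that)
    show "g holomorphic_on ball (poly f a) \<rho>" using holomorphic_on_subset[OF g(1) \<rho>(2)] .
    show "g (poly f a) = a" using g(2) s(1) by simp
    show "g t \<in> ball a e \<and> poly f (g t) = t" if t: "t \<in> ball (poly f a) \<rho>" for t
    proof -
      obtain z where "z \<in> ball a s" "t = poly f z" using t \<rho>(2) by blast
      then show ?thesis using g(2) s(2) by auto
    qed
  qed fact
qed

text \<open>The inverse function theorem provides disjoint local branches; they exhaust the nearby fibres
  by counting, since every regular fibre has \<open>degree f\<close> points.\<close>

lemma root_branches_exist:
  assumes "degree f > 0" "t0 \<notin> critical_values f"
  obtains r g where "root_branches f t0 r g"
proof -
  let ?F = "fiber f t0"
  have fin: "finite ?F" using fiber_finite assms(1) by blast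
  have "open (- critical_values f)" using open_regular_values assms(1) .
  then obtain r0 where r0: "r0 > 0" "ball t0 r0 \<subseteq> - critical_values f"
    using openE[of "- critical_values f" t0] assms(2) by auto
  obtain e where e: "e > 0" "\<And>a b. a \<in> ?F \<Longrightarrow> b \<in> ?F \<Longrightarrow> a \<noteq> b \<Longrightarrow> 2 * e \<le> dist a b"
  proof -
    \<comment> \<open>\<open>e\<close> is half the least distance between two roots; the inserted 1
      keeps the minimum defined when there is only one root.\<close>
    let ?E = "insert 1 ((\<lambda>(a, b). dist a b) ` {(a, b) \<in> ?F \<times> ?F. a \<noteq> b})"
    have "finite {(a, b) \<in> ?F \<times> ?F. a \<noteq> b}"
      by (rule finite_subset[of _ "?F \<times> ?F"]) (use fin in auto)
    then have E: "finite ?E" by simp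
    have "Min ?E > 0" using E by (subst Min_gr_iff) auto
    moreover have "Min ?E \<le> dist a b" if "a \<in> ?F" "b \<in> ?F" "a \<noteq> b" for a b
      using E that by (intro Min_le) (auto intro!: image_eqI[of _ _ "(a, b)"])
    ultimately show ?thesis using that[of "Min ?E / 2"] by simp
  qed
  have "\<exists>\<rho> g. \<rho> > 0 \<and> g holomorphic_on ball t0 \<rho> \<and> g t0 = a \<and>
      (\<forall>t\<in>ball t0 \<rho>. g t \<in> ball a e \<and> poly f (g t) = t)" if "a \<in> ?F" for a
  proof -
    have "poly f a = t0" using that by (simp add: fiber_def)
    moreover from this have "poly (pderiv f) a \<noteq> 0"
      using assms(2) by (auto simp: critical_values_def)
    ultimately show ?thesis using locally_biholomorphic[of f a e] e(1) by metis
  qed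
  then obtain \<rho> g where g: "\<And>a. a \<in> ?F \<Longrightarrow> \<rho> a > 0" "\<And>a. a \<in> ?F \<Longrightarrow> g a holomorphic_on ball t0 (\<rho> a)"
      "\<And>a. a \<in> ?F \<Longrightarrow> g a t0 = a"
      "\<And>a t. a \<in> ?F \<Longrightarrow> t \<in> ball t0 (\<rho> a) \<Longrightarrow> g a t \<in> ball a e \<and> poly f (g a t) = t"
    by metis
  define r where "r = Min (insert r0 (\<rho> ` ?F))"
  have r: "r > 0" "r \<le> r0" "\<And>a. a \<in> ?F \<Longrightarrow> r \<le> \<rho> a"
    using fin g(1) r0 by (auto simp: r_def Min_gr_iff)
  have "bij_betw (\<lambda>a. g a t) ?F (fiber f t)" if t: "t \<in> ball t0 r" for t
  proof -
    have inj: "inj_on (\<lambda>a. g a t) ?F"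
    proof (rule inj_onI, rule ccontr)
      fix a b assume ab: "a \<in> ?F" "b \<in> ?F" "g a t = g b t" "a \<noteq> b"
      then have "g a t \<in> ball a e" "g a t \<in> ball b e"
        using g(4)[of a t] g(4)[of b t] r(3)[of a] r(3)[of b] t by auto
      then have "dist a b < 2 * e"
        using dist_triangle_half_l[of a "g a t" "2 * e" b] by simp
      with e(2) ab show False by fastforce
    qed
    have sub: "(\<lambda>a. g a t) ` ?F \<subseteq> fiber f t"
      using g(4) r(3) t by (fastforce simp: fiber_def)
    have "t \<notin> critical_values f" using r0(2) r(2) t by (auto simp: subset_iff)
    then have "card ((\<lambda>a. g a t) ` ?F) = card (fiber f t)"
      using card_image[OF inj] assms by (simp add: card_fiber)
    then have "(\<lambda>a. g a t) ` ?F = fiber f t"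
      using sub fiber_finite[OF assms(1)] by (simp add: card_subset_eq)
    with inj show ?thesis by (simp add: bij_betw_def)
  qed
  moreover have "g a holomorphic_on ball t0 r" if "a \<in> ?F" for a
    using g(2)[OF that] by (rule holomorphic_on_subset) (use r(3)[OF that] in auto)
  ultimately have "root_branches f t0 r g"
    unfolding root_branches_def using r(1) order_trans[OF subset_ball[OF r(2)] r0(2)] g(3) by auto
  then show ?thesis using that by blast
qed

text \<open>A branch is injective because \<open>f\<close> is a left inverse of its values, so the
  open mapping theorem applies.\<close>

lemma root_branches_open_image:
  assumes "root_branches f t0 r g" "a \<in> fiber f t0"
  shows "open (g a ` ball t0 r)"
proof -
  note D = root_branchesD[OF assms(1)]
  have "inj_on (g a) (ball t0 r)" using D(10)[OF _ assms(2)] by (metis inj_onI)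
  then show ?thesis by (intro open_mapping_thm3 D(4) assms(2)) auto
qed

text \<open>The sheets over a disc are the images of the branches. If two of them meet, applying
  \<open>f\<close> shows that the parameters agree, and injectivity at that parameter makes the
  branches equal. Path lifting then comes from the theory of covering spaces.\<close>

lemma poly_covering_space:
  assumes "degree f > 0"
  shows "covering_space (poly f -` (- critical_values f)) (poly f) (- critical_values f)"
proof
  let ?C = "poly f -` (- critical_values f)"
  have op: "open (- critical_values f)" using open_regular_values[OF assms] .
  have opC: "open ?C" by (rule open_vimage[OF op]) (intro continuous_intros)
  show "continuous_on ?C (poly f)" by (intro continuous_intros)
  have "t \<in> poly f ` ?C" if "t \<notin> critical_values f" for t
  proof -
    have "card (fiber f t) > 0" using card_fiber assms that by simp
    then obtain x where "x \<in> fiber f t" by (auto simp: card_gt_0_iff)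
    then show ?thesis using that by (auto simp: fiber_def)
  qed
  then show "poly f ` ?C = - critical_values f" by blast
  fix t0 assume "t0 \<in> - critical_values f"
  then obtain r g where rg: "root_branches f t0 r g" using root_branches_exist assms by blast
  note D = root_branchesD[OF rg]
  let ?T = "ball t0 r" and ?F = "fiber f t0"
  let ?v = "(\<lambda>a. g a ` ?T) ` ?F"
  show "\<exists>T. t0 \<in> T \<and> openin (top_of_set (- critical_values f)) T \<and>
       (\<exists>v. \<Union>v = ?C \<inter> poly f -` T \<and> (\<forall>u\<in>v. openin (top_of_set ?C) u) \<and>
         pairwise disjnt v \<and> (\<forall>u\<in>v. \<exists>q. homeomorphism u T (poly f) q))"
  proof (intro exI[of _ ?T] exI[of _ ?v] conjI ballI)
    show "t0 \<in> ?T" by fact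
    show "openin (top_of_set (- critical_values f)) ?T" using D(3) op by (simp add: openin_open_eq)
    show "\<Union>?v = ?C \<inter> poly f -` ?T"
    proof (intro set_eqI iffI)
      fix x assume "x \<in> \<Union>?v"
      then show "x \<in> ?C \<inter> poly f -` ?T" using D(3,10) by auto
    next
      fix x assume "x \<in> ?C \<inter> poly f -` ?T"
      then have "poly f x \<in> ?T" "x \<in> fiber f (poly f x)" by (auto simp: fiber_def)
      then have "x \<in> (\<lambda>a. g a (poly f x)) ` ?F" using D(7) by (simp add: bij_betw_def)
      then show "x \<in> \<Union>?v" using \<open>poly f x \<in> ?T\<close> by blast
    qed
    show "openin (top_of_set ?C) u" if u: "u \<in> ?v" for u
    proof -
      obtain a where a: "a \<in> ?F" "u = g a ` ?T" using u by blast
      have "open u" unfolding a using root_branches_open_image[OF rg a(1)] .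
      moreover have "u \<subseteq> ?C" using a D(3,10) by auto
      ultimately show ?thesis using opC by (simp add: openin_open_eq)
    qed
    show "pairwise disjnt ?v"
    proof (clarsimp simp: pairwise_def disjnt_def)
      fix a b assume ab: "a \<in> ?F" "b \<in> ?F" "g a ` ?T \<noteq> g b ` ?T"
      have False if s: "s \<in> ?T" and t: "t \<in> ?T" and eq: "g a s = g b t" for s t
      proof -
        have "s = t" using D(10)[OF s ab(1)] D(10)[OF t ab(2)] eq by simp
        then have "a = b" using D(8)[OF s] eq ab by (metis inj_onD)
        then show False using ab by simp
      qed
      then show "g a ` ?T \<inter> g b ` ?T = {}" by blast
    qed
    show "\<exists>q. homeomorphism u ?T (poly f) q" if u: "u \<in> ?v" for u
    proof -
      obtain a where a: "a \<in> ?F" "u = g a ` ?T" using u by blast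
      have "homeomorphism u ?T (poly f) (g a)"
        unfolding homeomorphism_def a(2) using D(5,10) a(1)
        by (auto intro!: continuous_intros simp: image_iff)
      then show ?thesis by blast
    qed
  qed
qed

subsection \<open>Monodromy and root pairs\<close>

text \<open>The lifts may agree at any parameter \<open>a\<close>: agreement at 0 gives uniqueness
  of endpoints, at 1 injectivity of continuation, and in between it shows that distinct lifts never
  meet.\<close>

lemma lift_unique:
  assumes "degree f > 0" "path p" "path_image p \<subseteq> - critical_values f"
    and "path q" "\<And>s. s \<in> {0..1} \<Longrightarrow> poly f (q s) = p s"
    and "path r" "\<And>s. s \<in> {0..1} \<Longrightarrow> poly f (r s) = p s"
    and "q a = r a" "a \<in> {0..1}" "s \<in> {0..1}"
  shows "q s = r s"
proof (rule covering_space_lift_unique[OF poly_covering_space[OF assms(1)], of q a r "{0..1}" p])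
  have reg: "p s \<in> - critical_values f" if "s \<in> {0..1}" for s
    using assms(3) that unfolding path_image_def by blast
  then show "p \<in> {0..1} \<rightarrow> - critical_values f" by blast
  show "q \<in> {0..1} \<rightarrow> poly f -` (- critical_values f)" "r \<in> {0..1} \<rightarrow> poly f -` (- critical_values f)"
    using reg assms(5,7) by auto
  show "p s = poly f (q s)" "p s = poly f (r s)" if "s \<in> {0..1}" for s
    using assms(5,7)[OF that] by simp_all
  show "continuous_on {0..1} p" "continuous_on {0..1} q" "continuous_on {0..1} r"
    using assms(2,4,6) by (simp_all add: path_def)
qed (use assms(8-10) in auto)

lemma continues_toE:
  assumes "continues_to f p x y"
  obtains q where "path q" "q 0 = x" "q 1 = y" "\<And>s. s \<in> {0..1} \<Longrightarrow> poly f (q s) = p s"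
  using assms unfolding continues_to_def pathstart_def pathfinish_def by blast

lemma continues_to_fiber:
  assumes "continues_to f p x y"
  shows "x \<in> fiber f (pathstart p)" "y \<in> fiber f (pathfinish p)"
  using assms unfolding continues_to_def fiber_def pathstart_def pathfinish_def by force+

lemma continues_to_unique:
  assumes "degree f > 0" "path p" "path_image p \<subseteq> - critical_values f"
    and "continues_to f p x y" "continues_to f p x y'"
  shows "y = y'"
proof -
  obtain q where q: "path q" "q 0 = x" "q 1 = y" "\<And>s. s \<in> {0..1} \<Longrightarrow> poly f (q s) = p s"
    using continues_toE[OF assms(4)] by blast
  obtain r where r: "path r" "r 0 = x" "r 1 = y'" "\<And>s. s \<in> {0..1} \<Longrightarrow> poly f (r s) = p s"
    using continues_toE[OF assms(5)] by blast
  have "q 1 = r 1"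
    using lift_unique[OF assms(1-3) q(1,4) r(1,4), of 0 1] q(2) r(2) by simp
  with q r show ?thesis by simp
qed

lemma continues_to_inject:
  assumes "degree f > 0" "path p" "path_image p \<subseteq> - critical_values f"
    and "continues_to f p x y" "continues_to f p x' y"
  shows "x = x'"
proof -
  obtain q where q: "path q" "q 0 = x" "q 1 = y" "\<And>s. s \<in> {0..1} \<Longrightarrow> poly f (q s) = p s"
    using continues_toE[OF assms(4)] by blast
  obtain r where r: "path r" "r 0 = x'" "r 1 = y" "\<And>s. s \<in> {0..1} \<Longrightarrow> poly f (r s) = p s"
    using continues_toE[OF assms(5)] by blast
  have "q 0 = r 0"
    using lift_unique[OF assms(1-3) q(1,4) r(1,4), of 1 0] q(3) r(3) by simp
  with q r show ?thesis by simp
qed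

lemma continues_to_exists:
  assumes "degree f > 0" "path p" "path_image p \<subseteq> - critical_values f" "x \<in> fiber f (pathstart p)"
  obtains y where "continues_to f p x y"
proof -
  have "x \<in> poly f -` (- critical_values f)"
    using assms pathstart_in_path_image[of p] by (auto simp: fiber_def)
  then obtain h where "path h" "pathstart h = x" "\<And>s. s \<in> {0..1} \<Longrightarrow> poly f (h s) = p s"
    using covering_space_lift_path_strong[OF poly_covering_space[OF assms(1)] _ assms(2,3), of x]
      assms(4) by (auto simp: fiber_def)
  then have "continues_to f p x (pathfinish h)"
    unfolding continues_to_def by blast
  then show ?thesis using that by blast
qed

text \<open>Continuation along a loop is an injective self-map of a finite fibre, hence a
  permutation of it.\<close>

lemma monodromy_permutation_exists:
  assumes "degree f > 0" "path p" "path_image p \<subseteq> - critical_values f"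
    and "pathstart p = b" "pathfinish p = b"
  obtains \<sigma> where "\<sigma> \<in> monodromy_group f b" "\<And>x. x \<in> fiber f b \<Longrightarrow> continues_to f p x (\<sigma> x)"
proof -
  note p = assms(1-3)
  have "\<forall>x\<in>fiber f b. \<exists>y. continues_to f p x y"
    using continues_to_exists[OF p] assms(4) by metis
  then obtain h where h: "\<And>x. x \<in> fiber f b \<Longrightarrow> continues_to f p x (h x)" by metis
  define \<sigma> where "\<sigma> x = (if x \<in> fiber f b then h x else x)" for x
  have \<sigma>: "continues_to f p x (\<sigma> x)" if "x \<in> fiber f b" for x
    using h that by (simp add: \<sigma>_def)
  have inj: "inj_on \<sigma> (fiber f b)"
    by (rule inj_onI) (metis \<sigma> continues_to_inject[OF p])
  have "\<sigma> ` fiber f b \<subseteq> fiber f b"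
    using continues_to_fiber(2)[OF \<sigma>] assms(5) by auto
  then have "\<sigma> ` fiber f b = fiber f b"
    using inj fiber_finite[OF assms(1)] by (simp add: endo_inj_surj)
  then have "\<sigma> permutes fiber f b"
    using inj by (intro bij_imp_permutes) (auto simp: bij_betw_def \<sigma>_def)
  then have "\<sigma> \<in> monodromy_group f b"
    using assms \<sigma> unfolding monodromy_group_def by blast
  then show ?thesis using that \<sigma> by blast
qed

text \<open>The branch \<open>g a\<close> along the segment from \<open>b\<close> to
  \<open>t\<close> is a lift starting at \<open>a\<close>, and lifts are unique. This identifies the
  definite description with a holomorphic function.\<close>

lemma root_branch_eq:
  assumes "degree f > 0" "root_branches f b r g" "t \<in> ball b r" "a \<in> fiber f b"
  shows "root_branch f b t a = g a t"
proof -
  note D = root_branchesD[OF assms(2)]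
  have seg: "closed_segment b t \<subseteq> ball b r"
    using assms(3) D(2) by (simp add: closed_segment_subset)
  have reg: "path_image (linepath b t) \<subseteq> - critical_values f"
    using seg D(3) by auto
  have "path (g a \<circ> linepath b t)"
    by (rule path_continuous_image) (use D(5)[OF assms(4)] seg continuous_on_subset in auto)
  moreover have "poly f ((g a \<circ> linepath b t) s) = linepath b t s" if "s \<in> {0..1}" for s
    using D(10)[OF _ assms(4)] seg linepath_in_path[OF that, of b t] by auto
  ultimately have *: "continues_to f (linepath b t) a (g a t)"
    unfolding continues_to_def using D(6)[OF assms(4)]
    by (intro exI[of _ "g a \<circ> linepath b t"])
      (simp add: pathstart_compose pathfinish_compose)
  show ?thesis unfolding root_branch_def
  proof (rule the_equality)
    show "y = g a t" if "continues_to f (linepath b t) a y" for y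
      using continues_to_unique[OF assms(1) path_linepath reg that *] .
  qed fact
qed

text \<open>The curve of all simple cycles over regular values; a cycle family is a continuous map
  into it, and continuing a cycle means moving along a path in it.\<close>

definition root_pairs :: "complex poly \<Rightarrow> cycle set" where
  "root_pairs f = {(x, y). poly f x = poly f y \<and> x \<noteq> y \<and> poly f x \<notin> critical_values f}"

text \<open>Path components replace continuation along chosen paths, so this set depends on no
  choice of a path from \<open>b\<close> to \<open>t\<close>. That makes the product over it
  single-valued.\<close>

definition cycle_fiber :: "complex poly \<Rightarrow> cycle \<Rightarrow> complex \<Rightarrow> cycle set" where
  "cycle_fiber f \<gamma> t = {\<delta>. path_component (root_pairs f) \<gamma> \<delta> \<and> fst \<delta> \<in> fiber f t}"

lemma cycle_fiber_subset: "cycle_fiber f \<gamma> t \<subseteq> simple_cycles f t"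
proof
  fix \<delta> assume "\<delta> \<in> cycle_fiber f \<gamma> t"
  then have "\<delta> \<in> root_pairs f" "fst \<delta> \<in> fiber f t"
    unfolding cycle_fiber_def by (auto dest: path_component_mem(2))
  then show "\<delta> \<in> simple_cycles f t"
    by (auto simp: root_pairs_def simple_cycles_def fiber_def)
qed

lemma path_component_of_continues_to:
  assumes "degree f > 0" "path p" "path_image p \<subseteq> - critical_values f"
    and "continues_to f p x x'" "continues_to f p y y'" "x \<noteq> y"
  shows "path_component (root_pairs f) (x, y) (x', y')"
proof -
  obtain q where q: "path q" "q 0 = x" "q 1 = x'" "\<And>s. s \<in> {0..1} \<Longrightarrow> poly f (q s) = p s"
    using continues_toE[OF assms(4)] by blast
  obtain r where r: "path r" "r 0 = y" "r 1 = y'" "\<And>s. s \<in> {0..1} \<Longrightarrow> poly f (r s) = p s"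
    using continues_toE[OF assms(5)] by blast
  \<comment> \<open>If the two lifts met at \<open>s\<close>, uniqueness from \<open>s\<close> back
    to 0 would give \<open>x = y\<close>.\<close>
  have "q s \<noteq> r s" if "s \<in> {0..1}" for s
    using lift_unique[OF assms(1-3) q(1,4) r(1,4), of s 0] q(2) r(2) that assms(6) by auto
  moreover have "p s \<notin> critical_values f" if "s \<in> {0..1}" for s
    using assms(3) that unfolding path_image_def by blast
  ultimately have "path_image (\<lambda>s. (q s, r s)) \<subseteq> root_pairs f"
    using q(4) r(4) by (auto simp: path_image_def root_pairs_def)
  moreover have "path (\<lambda>s. (q s, r s))"
    using q(1) r(1) unfolding path_def by (intro continuous_on_Pair)
  ultimately show ?thesis
    unfolding path_component_def using q(2,3) r(2,3)
    by (intro exI[of _ "\<lambda>s. (q s, r s)"]) (simp add: pathstart_def pathfinish_def)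
qed

text \<open>Conversely, the image under \<open>f\<close> of a path in the curve is a path of regular
  values, and the two coordinates are its lifts.\<close>

lemma continues_to_of_path_component:
  assumes "path_component (root_pairs f) (x, y) (x', y')"
  obtains p where "path p" "path_image p \<subseteq> - critical_values f"
    "pathstart p = poly f x" "pathfinish p = poly f x'" "continues_to f p x x'" "continues_to f p y y'"
proof -
  obtain h where h: "path h" "path_image h \<subseteq> root_pairs f" "pathstart h = (x, y)" "pathfinish h = (x', y')"
    using assms unfolding path_component_def by blast
  have hs: "poly f (fst (h s)) = poly f (snd (h s))" "poly f (fst (h s)) \<notin> critical_values f"
    if "s \<in> {0..1}" for s
  proof -
    have "h s \<in> root_pairs f" using h(2) that by (auto simp: path_image_def)
    then show "poly f (fst (h s)) = poly f (snd (h s))" "poly f (fst (h s)) \<notin> critical_values f"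
      by (auto simp: root_pairs_def)
  qed
  show ?thesis
  proof (rule that)
    show "path (\<lambda>s. poly f (fst (h s)))"
      using h(1) unfolding path_def by (intro continuous_intros)
    show "path_image (\<lambda>s. poly f (fst (h s))) \<subseteq> - critical_values f"
      using hs by (auto simp: path_image_def)
    show "continues_to f (\<lambda>s. poly f (fst (h s))) x x'"
      unfolding continues_to_def
      by (rule exI[of _ "\<lambda>s. fst (h s)"])
        (use h in \<open>auto simp: path_def pathstart_def pathfinish_def intro!: continuous_intros\<close>)
    show "continues_to f (\<lambda>s. poly f (fst (h s))) y y'"
      unfolding continues_to_def
      by (rule exI[of _ "\<lambda>s. snd (h s)"])
        (use h hs in \<open>auto simp: path_def pathstart_def pathfinish_def intro!: continuous_intros\<close>)
  qed (use h in \<open>auto simp: pathstart_def pathfinish_def\<close>)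
qed

text \<open>A loop at \<open>b\<close> lifts to a path in the curve joining two cycles over
  \<open>b\<close>, and every such path projects to a loop. The permutation of that loop has the
  prescribed values by uniqueness of continuation.\<close>

lemma cycle_orbit_eq_cycle_fiber:
  assumes "degree f > 0" "\<gamma> \<in> simple_cycles f b"
  shows "cycle_orbit f b \<gamma> = cycle_fiber f \<gamma> b"
proof (intro set_eqI iffI)
  obtain x y where \<gamma>: "\<gamma> = (x, y)" "x \<in> fiber f b" "y \<in> fiber f b" "x \<noteq> y"
    using assms(2) by (auto simp: simple_cycles_def)
  {
    fix \<delta> assume "\<delta> \<in> cycle_orbit f b \<gamma>"
    then obtain \<sigma> where \<sigma>: "\<sigma> \<in> monodromy_group f b" "\<delta> = (\<sigma> x, \<sigma> y)"
      by (auto simp: cycle_orbit_def \<gamma>)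
    then obtain p where p: "path p" "path_image p \<subseteq> - critical_values f" "pathfinish p = b"
        "\<forall>x\<in>fiber f b. continues_to f p x (\<sigma> x)"
      unfolding monodromy_group_def by blast
    then have "path_component (root_pairs f) (x, y) (\<sigma> x, \<sigma> y)"
      using \<gamma> assms(1) by (intro path_component_of_continues_to[of f p]) auto
    moreover have "\<sigma> x \<in> fiber f b"
      using continues_to_fiber(2) p \<gamma>(2) by metis
    ultimately show "\<delta> \<in> cycle_fiber f \<gamma> b"
      by (simp add: cycle_fiber_def \<sigma>(2) \<gamma>(1))
  next
    fix \<delta> assume "\<delta> \<in> cycle_fiber f \<gamma> b"
    then obtain x' y' where \<delta>: "\<delta> = (x', y')" "x' \<in> fiber f b"
        "path_component (root_pairs f) (x, y) (x', y')"
      by (cases \<delta>) (auto simp: cycle_fiber_def \<gamma>(1))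
    obtain p where p: "path p" "path_image p \<subseteq> - critical_values f" "pathstart p = b"
        "pathfinish p = b" "continues_to f p x x'" "continues_to f p y y'"
      using continues_to_of_path_component[OF \<delta>(3)] \<delta>(2) \<gamma>(2) unfolding fiber_def by auto
    obtain \<sigma> where \<sigma>: "\<sigma> \<in> monodromy_group f b" "\<And>x. x \<in> fiber f b \<Longrightarrow> continues_to f p x (\<sigma> x)"
      using monodromy_permutation_exists[OF assms(1) p(1-4)] by blast
    have "\<sigma> x = x'" "\<sigma> y = y'"
      using continues_to_unique[OF assms(1) p(1,2)] \<sigma>(2) \<gamma> p by blast+
    then show "\<delta> \<in> cycle_orbit f b \<gamma>"
      using \<sigma>(1) by (auto simp: cycle_orbit_def \<gamma>(1) \<delta>(1))
  }
qed

lemma path_component_root_branches: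
  assumes "root_branches f t0 r g" "a \<in> fiber f t0" "a' \<in> fiber f t0" "a \<noteq> a'"
    and "s \<in> ball t0 r" "t \<in> ball t0 r"
  shows "path_component (root_pairs f) (g a s, g a' s) (g a t, g a' t)"
proof -
  note D = root_branchesD[OF assms(1)]
  let ?I = "(\<lambda>t. (g a t, g a' t)) ` ball t0 r"
  have "path_connected ?I"
    by (intro path_connected_continuous_image continuous_on_Pair D(5) assms
        convex_imp_path_connected convex_ball)
  then have "path_component ?I (g a s, g a' s) (g a t, g a' t)"
    using assms(5,6) by (auto simp: path_connected_component)
  moreover have "(g a t, g a' t) \<in> root_pairs f" if "t \<in> ball t0 r" for t
    using that D(3) D(10)[OF that assms(2)] D(10)[OF that assms(3)]
      inj_on_contraD[OF D(8)[OF that] assms(4,2,3)] unfolding root_pairs_def by auto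
  then have "?I \<subseteq> root_pairs f" by blast
  ultimately show ?thesis using path_component_of_subset by blast
qed

text \<open>Moving a pair of branches over the connected disc does not leave its path component, so
  the fibres of a component are locally trivial.\<close>

lemma cycle_fiber_root_branches:
  assumes "root_branches f t0 r g" "t \<in> ball t0 r"
  shows "cycle_fiber f \<gamma> t = map_prod (\<lambda>a. g a t) (\<lambda>a. g a t) ` cycle_fiber f \<gamma> t0"
proof (intro set_eqI iffI)
  note D = root_branchesD[OF assms(1)]
  {
    fix \<delta> assume \<delta>: "\<delta> \<in> cycle_fiber f \<gamma> t"
    then have "\<delta> \<in> simple_cycles f t" using cycle_fiber_subset by blast
    then obtain x y where xy: "\<delta> = (x, y)" "x \<in> fiber f t" "y \<in> fiber f t" "x \<noteq> y"
      by (auto simp: simple_cycles_def)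
    then obtain a a' where a: "a \<in> fiber f t0" "a' \<in> fiber f t0" "x = g a t" "y = g a' t"
      using D(7)[OF assms(2)] unfolding bij_betw_def by (metis imageE)
    with xy have "path_component (root_pairs f) (x, y) (g a t0, g a' t0)"
      using path_component_root_branches[OF assms(1) a(1,2) _ assms(2) D(2)] by auto
    then have "path_component (root_pairs f) \<gamma> (a, a')"
      using \<delta> D(6) a path_component_trans by (auto simp: cycle_fiber_def xy(1))
    then have "(a, a') \<in> cycle_fiber f \<gamma> t0" using a by (simp add: cycle_fiber_def)
    then show "\<delta> \<in> map_prod (\<lambda>a. g a t) (\<lambda>a. g a t) ` cycle_fiber f \<gamma> t0"
      using a xy by (auto intro: image_eqI[of _ _ "(a, a')"])
  next
    fix \<delta> assume "\<delta> \<in> map_prod (\<lambda>a. g a t) (\<lambda>a. g a t) ` cycle_fiber f \<gamma> t0"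
    then obtain a a' where a: "(a, a') \<in> cycle_fiber f \<gamma> t0" "\<delta> = (g a t, g a' t)" by auto
    have "(a, a') \<in> simple_cycles f t0" using a cycle_fiber_subset by blast
    then have aa: "a \<in> fiber f t0" "a' \<in> fiber f t0" "a \<noteq> a'" by (auto simp: simple_cycles_def)
    have "path_component (root_pairs f) (a, a') (g a t, g a' t)"
      using path_component_root_branches[OF assms(1) aa D(2) assms(2)] D(6) aa by simp
    then show "\<delta> \<in> cycle_fiber f \<gamma> t"
      using a D(9)[OF assms(2) aa(1)] path_component_trans by (auto simp: cycle_fiber_def)
  }
qed

section \<open>Products over cycles up to sign\<close>

definition cycle_product :: "complex poly \<Rightarrow> cycle set \<Rightarrow> complex" where
  "cycle_product \<omega> A = (\<Prod>c\<in>A // cycle_sign_rel. cycle_quotient \<omega> (SOME \<gamma>. \<gamma> \<in> c))"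

lemma cycle_sign_class: "cycle_sign_rel `` {\<gamma>} = {\<gamma>, prod.swap \<gamma>}"
  by (auto simp: cycle_sign_rel_def)

lemma cycle_sign_quotientE:
  assumes "c \<in> A // cycle_sign_rel"
  obtains \<gamma> where "\<gamma> \<in> A" "c = {\<gamma>, prod.swap \<gamma>}"
  using assms unfolding quotient_def cycle_sign_class by blast

lemma cycle_sign_quotientI: "\<gamma> \<in> A \<Longrightarrow> {\<gamma>, prod.swap \<gamma>} \<in> A // cycle_sign_rel"
  unfolding quotient_def cycle_sign_class by blast

lemma swap_invariant_some:
  assumes "\<And>\<gamma>. h (prod.swap \<gamma>) = h \<gamma>"
  shows "h (SOME \<delta>. \<delta> \<in> {\<gamma>, prod.swap \<gamma>}) = h \<gamma>"
proof -
  have "(SOME \<delta>. \<delta> \<in> {\<gamma>, prod.swap \<gamma>}) \<in> {\<gamma>, prod.swap \<gamma>}"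
    by (rule someI[of _ \<gamma>]) simp
  then show ?thesis using assms[of \<gamma>] by auto
qed

text \<open>The map commutes with the swap, so it carries sign classes bijectively to sign classes.
  The representative chosen in an image class may differ from the image of the chosen one, but only
  by a swap, which leaves the quotient unchanged.\<close>

lemma cycle_product_map_prod:
  assumes "A \<subseteq> F \<times> F" "inj_on g F"
  shows "cycle_product \<omega> (map_prod g g ` A) =
    (\<Prod>c\<in>A // cycle_sign_rel. cycle_quotient \<omega> (map_prod g g (SOME \<gamma>. \<gamma> \<in> c)))"
proof -
  let ?\<phi> = "map_prod g g"
  have swap: "?\<phi> (prod.swap \<gamma>) = prod.swap (?\<phi> \<gamma>)" for \<gamma>
    by (cases \<gamma>) simp
  have img: "?\<phi> ` {\<gamma>, prod.swap \<gamma>} = {?\<phi> \<gamma>, prod.swap (?\<phi> \<gamma>)}" for \<gamma>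
    by (simp add: swap)
  have inj: "inj_on ?\<phi> (F \<times> F)" using assms(2) by (rule map_prod_inj_on[OF _ assms(2)])
  have sub: "c \<subseteq> F \<times> F" if "c \<in> A // cycle_sign_rel" for c
    using that assms(1) by (elim cycle_sign_quotientE) auto
  have inj': "inj_on ((`) ?\<phi>) (A // cycle_sign_rel)"
    by (rule inj_onI) (use inj_on_image_eq_iff[OF inj] sub in blast)
  have "(`) ?\<phi> ` (A // cycle_sign_rel) = (?\<phi> ` A) // cycle_sign_rel"
    unfolding quotient_def cycle_sign_class UNION_singleton_eq_range image_image by (simp add: swap)
  then have "cycle_product \<omega> (?\<phi> ` A) =
      (\<Prod>c\<in>A // cycle_sign_rel. cycle_quotient \<omega> (SOME \<gamma>. \<gamma> \<in> ?\<phi> ` c))"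
    unfolding cycle_product_def using prod.reindex[OF inj'] by simp
  also have "\<dots> = (\<Prod>c\<in>A // cycle_sign_rel. cycle_quotient \<omega> (?\<phi> (SOME \<gamma>. \<gamma> \<in> c)))"
  proof (rule prod.cong[OF refl])
    fix c assume "c \<in> A // cycle_sign_rel"
    then obtain \<gamma> where c: "c = {\<gamma>, prod.swap \<gamma>}" by (rule cycle_sign_quotientE)
    show "cycle_quotient \<omega> (SOME \<gamma>. \<gamma> \<in> ?\<phi> ` c) = cycle_quotient \<omega> (?\<phi> (SOME \<gamma>. \<gamma> \<in> c))"
      unfolding c img swap_invariant_some[of "cycle_quotient \<omega>", OF cycle_quotient_swap]
      by (subst swap_invariant_some[of "\<lambda>\<gamma>. cycle_quotient \<omega> (?\<phi> \<gamma>)"])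
        (simp_all only: swap cycle_quotient_swap)
  qed
  finally show ?thesis .
qed

text \<open>The index set is now frozen at the centre \<open>t0\<close> and only the factors vary
  with \<open>t\<close>, which is the form suited to holomorphy.\<close>

lemma cycle_product_root_branches:
  assumes "root_branches f t0 r g" "t \<in> ball t0 r"
  shows "cycle_product \<omega> (cycle_fiber f \<gamma> t) =
    (\<Prod>c\<in>cycle_fiber f \<gamma> t0 // cycle_sign_rel.
       cycle_quotient \<omega> (map_prod (\<lambda>a. g a t) (\<lambda>a. g a t) (SOME \<gamma>. \<gamma> \<in> c)))"
  unfolding cycle_fiber_root_branches[OF assms]
proof (rule cycle_product_map_prod)
  show "cycle_fiber f \<gamma> t0 \<subseteq> fiber f t0 \<times> fiber f t0"
    using cycle_fiber_subset[of f \<gamma> t0] by (auto simp: simple_cycles_def)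
  show "inj_on (\<lambda>a. g a t) (fiber f t0)" using root_branchesD(8)[OF assms] .
qed

text \<open>A class contains the swap of its cycle even when that swap lies outside the component,
  so the chosen element is only known to be a simple cycle.\<close>

lemma some_cycle_sign_class:
  assumes "c \<in> cycle_fiber f \<gamma> t // cycle_sign_rel"
  shows "(SOME \<gamma>. \<gamma> \<in> c) \<in> simple_cycles f t"
proof -
  obtain \<delta> where \<delta>: "\<delta> \<in> cycle_fiber f \<gamma> t" "c = {\<delta>, prod.swap \<delta>}"
    using assms by (rule cycle_sign_quotientE)
  then have "c \<subseteq> simple_cycles f t"
    using cycle_fiber_subset[of f \<gamma> t] by (auto simp: simple_cycles_def)
  moreover have "(SOME \<gamma>. \<gamma> \<in> c) \<in> c" by (rule someI[of _ \<delta>]) (simp add: \<delta>)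
  ultimately show ?thesis by blast
qed

subsection \<open>The orbit product\<close>

lemma finite_simple_cycles:
  assumes "degree f > 0"
  shows "finite (simple_cycles f t)"
  by (rule finite_subset[of _ "fiber f t \<times> fiber f t"])
    (use fiber_finite[OF assms] in \<open>auto simp: simple_cycles_def\<close>)

lemma card_simple_cycles_le:
  assumes "degree f > 0"
  shows "card (simple_cycles f t) \<le> degree f * (degree f - 1)"
proof -
  have fin: "finite (fiber f t)" using fiber_finite assms .
  have "simple_cycles f t = (SIGMA x:fiber f t. fiber f t - {x})"
    by (auto simp: simple_cycles_def)
  then have "card (simple_cycles f t) = card (fiber f t) * (card (fiber f t) - 1)"
    using fin by simp
  also have "\<dots> \<le> degree f * (degree f - 1)"
    using card_fiber_le[OF assms, of t] by (intro mult_le_mono diff_le_mono)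
  finally show ?thesis .
qed

lemma finite_cycle_fiber:
  assumes "degree f > 0"
  shows "finite (cycle_fiber f \<gamma> t)"
  using finite_subset[OF cycle_fiber_subset finite_simple_cycles[OF assms]] .

lemma finite_cycle_classes:
  assumes "degree f > 0"
  shows "finite (cycle_fiber f \<gamma> t // cycle_sign_rel)"
  using finite_cycle_fiber[OF assms] by (simp add: quotient_def)

text \<open>The classes are disjoint two-element sets of simple cycles, whether or not the component
  is closed under swapping. This is where the factor 1/2 of the final bound arises.\<close>

lemma card_cycle_classes_le:
  assumes "degree f > 0"
  shows "2 * card (cycle_fiber f \<gamma> t // cycle_sign_rel) \<le> degree f * (degree f - 1)"
proof -
  let ?Q = "cycle_fiber f \<gamma> t // cycle_sign_rel"
  have sub: "\<Union>?Q \<subseteq> simple_cycles f t"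
  proof
    fix \<delta> assume "\<delta> \<in> \<Union>?Q"
    then obtain c where c: "c \<in> ?Q" "\<delta> \<in> c" by blast
    then obtain \<eta> where "\<eta> \<in> cycle_fiber f \<gamma> t" "c = {\<eta>, prod.swap \<eta>}" by (blast elim: cycle_sign_quotientE)
    then show "\<delta> \<in> simple_cycles f t"
      using c cycle_fiber_subset[of f \<gamma> t] by (auto simp: simple_cycles_def)
  qed
  have "2 * card ?Q = card (\<Union>?Q)"
  proof (rule card_partition)
    show "finite (\<Union>?Q)" using finite_subset[OF sub finite_simple_cycles[OF assms]] .
    fix c assume "c \<in> ?Q"
    then obtain \<eta> where \<eta>: "\<eta> \<in> cycle_fiber f \<gamma> t" "c = {\<eta>, prod.swap \<eta>}" by (rule cycle_sign_quotientE)
    then have "\<eta> \<noteq> prod.swap \<eta>"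
      using cycle_fiber_subset[of f \<gamma> t] by (cases \<eta>) (auto simp: simple_cycles_def)
    then show "card c = 2" using \<eta> by simp
  next
    fix c c' assume "c \<in> ?Q" "c' \<in> ?Q" "c \<noteq> c'"
    then show "c \<inter> c' = {}"
      by (elim cycle_sign_quotientE) auto
  qed (fact finite_cycle_classes[OF assms])
  also have "\<dots> \<le> card (simple_cycles f t)"
    using card_mono[OF finite_simple_cycles[OF assms] sub] .
  also have "\<dots> \<le> degree f * (degree f - 1)" using card_simple_cycles_le[OF assms] .
  finally show ?thesis .
qed

text \<open>Each of the at most \<open>d (d - 1) / 2\<close> factors is \<open>O(L ^ (n - 1))\<close>, where \<open>L\<close> bounds the roots
  of \<open>f = t\<close> and \<open>L ^ d = O(t)\<close>. Squaring avoids fractional exponents.\<close>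

lemma norm_cycle_product_le:
  assumes "degree f > 0"
  obtains C where "C \<ge> 0"
    "\<And>t. norm (cycle_product \<omega> (cycle_fiber f \<gamma> t)) ^ 2 \<le>
       C * (1 + norm t) ^ ((degree \<omega> - 1) * (degree f - 1))"
proof -
  define d n where "d = degree f" and "n = degree \<omega> - 1"
  have d: "d > 0" using assms by (simp add: d_def)
  obtain C1 where C1: "C1 \<ge> 1" "\<And>M x y. norm x \<le> M \<Longrightarrow> norm y \<le> M \<Longrightarrow>
       norm (poly \<omega> x - poly \<omega> y) \<le> C1 * (1 + M) ^ n * norm (x - y)"
    using norm_poly_diff_le[of \<omega>] unfolding n_def by blast
  have "f \<noteq> 0" using assms by auto
  then obtain C0 where C0: "C0 > 0" "\<And>x. (1 + norm x) ^ d \<le> C0 * (1 + norm (poly f x))"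
    using power_degree_le_norm_poly[of f] unfolding d_def by blast
  \<comment> \<open>Constants of at least 1 ensure that \<open>L\<close> and \<open>B\<close> are at
    least 1.\<close>
  define C2 where "C2 = max 1 C0"
  have C2: "C2 \<ge> 1" "\<And>x. (1 + norm x) ^ d \<le> C2 * (1 + norm (poly f x))"
    unfolding C2_def by (auto intro!: order_trans[OF C0(2)] mult_right_mono)
  have "norm (cycle_product \<omega> (cycle_fiber f \<gamma> t)) ^ 2 \<le>
       C1 ^ (d * (d - 1)) * C2 ^ (n * (d - 1)) * (1 + norm t) ^ (n * (d - 1))" for t
  proof -
    define L where "L = root d (C2 * (1 + norm t))"
    have "1 * 1 \<le> C2 * (1 + norm t)" using C2(1) by (intro mult_mono) auto
    then have L: "L \<ge> 1" "L ^ d = C2 * (1 + norm t)"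
      using d C2(1) by (auto simp: L_def)
    define B where "B = C1 * L ^ n"
    have "1 * 1 \<le> C1 * L ^ n"
      using C1(1) L(1) by (intro mult_mono one_le_power) auto
    then have B: "B \<ge> 1" by (simp add: B_def)
    have root: "norm x \<le> L - 1" if "x \<in> fiber f t" for x
    proof -
      have "(1 + norm x) ^ d \<le> L ^ d" using C2(2)[of x] that L(2) by (simp add: fiber_def)
      then have "1 + norm x \<le> L" using L(1) d by (subst (asm) power_mono_iff) auto
      then show ?thesis by simp
    qed
    have quot: "norm (cycle_quotient \<omega> \<delta>) \<le> B" if \<delta>: "\<delta> \<in> simple_cycles f t" for \<delta>
    proof -
      obtain x y where xy: "\<delta> = (x, y)" "x \<in> fiber f t" "y \<in> fiber f t" "x \<noteq> y"
        using \<delta> by (auto simp: simple_cycles_def)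
      have "norm (poly \<omega> x - poly \<omega> y) \<le> B * norm (x - y)"
        using C1(2)[OF root[OF xy(2)] root[OF xy(3)]] by (simp add: B_def)
      then show ?thesis
        using xy by (simp add: cycle_quotient_def cycle_integral_def norm_divide divide_le_eq)
    qed
    let ?Q = "cycle_fiber f \<gamma> t // cycle_sign_rel"
    have "norm (cycle_product \<omega> (cycle_fiber f \<gamma> t)) =
        (\<Prod>c\<in>?Q. norm (cycle_quotient \<omega> (SOME \<gamma>. \<gamma> \<in> c)))"
      by (simp add: cycle_product_def prod_norm)
    also have "\<dots> \<le> (\<Prod>c\<in>?Q. B)"
      by (intro prod_mono conjI quot some_cycle_sign_class) auto
    finally have "norm (cycle_product \<omega> (cycle_fiber f \<gamma> t)) \<le> B ^ card ?Q" by simp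
    then have "norm (cycle_product \<omega> (cycle_fiber f \<gamma> t)) ^ 2 \<le> (B ^ card ?Q) ^ 2"
      by (intro power_mono) auto
    also have "\<dots> = B ^ (2 * card ?Q)" by (simp add: power_mult[symmetric] mult.commute)
    \<comment> \<open>The number of factors is only bounded from above, so raising the exponent uses
      that \<open>B\<close> is at least 1.\<close>
    also have "\<dots> \<le> B ^ (d * (d - 1))"
      using card_cycle_classes_le[OF assms, of \<gamma> t] B unfolding d_def by (intro power_increasing)
    also have "\<dots> = C1 ^ (d * (d - 1)) * L ^ (n * (d * (d - 1)))"
      by (simp add: B_def power_mult_distrib power_mult)
    also have "L ^ (n * (d * (d - 1))) = (L ^ d) ^ (n * (d - 1))"
      by (simp add: power_mult[symmetric] mult_ac)
    also have "\<dots> = C2 ^ (n * (d - 1)) * (1 + norm t) ^ (n * (d - 1))"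
      by (simp add: L(2) power_mult_distrib)
    finally show ?thesis by (simp add: mult.assoc)
  qed
  moreover have "C1 ^ (d * (d - 1)) * C2 ^ (n * (d - 1)) \<ge> 0"
    using C1(1) C2(1) by simp
  ultimately show ?thesis using that unfolding d_def n_def by blast
qed

text \<open>The denominator has no zero because distinct branches never meet over the disc.\<close>

lemma cycle_quotient_root_branches_holomorphic:
  assumes "root_branches f t0 r g" "\<delta> \<in> simple_cycles f t0"
  shows "(\<lambda>t. cycle_quotient \<omega> (map_prod (\<lambda>a. g a t) (\<lambda>a. g a t) \<delta>)) holomorphic_on ball t0 r"
proof -
  note D = root_branchesD[OF assms(1)]
  obtain a a' where a: "\<delta> = (a, a')" "a \<in> fiber f t0" "a' \<in> fiber f t0" "a \<noteq> a'"
    using assms(2) by (auto simp: simple_cycles_def)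
  have "g a t - g a' t \<noteq> 0" if "t \<in> ball t0 r" for t
    using inj_on_contraD[OF D(8)[OF that] a(4,2,3)] by simp
  moreover have "(\<lambda>t. poly \<omega> (g a t)) holomorphic_on ball t0 r" if "a \<in> fiber f t0" for a
    using D(4)[OF that] by (intro holomorphic_intros)
  ultimately show ?thesis
    using D(4) a(2,3) unfolding a(1) cycle_quotient_def cycle_integral_def
    by (auto intro!: holomorphic_intros)
qed

lemma cycle_product_holomorphic:
  assumes "degree f > 0"
  shows "(\<lambda>t. cycle_product \<omega> (cycle_fiber f \<gamma> t)) holomorphic_on - critical_values f"
  unfolding holomorphic_on_def
proof
  fix t0 assume "t0 \<in> - critical_values f"
  then obtain r g where rg: "root_branches f t0 r g" using root_branches_exist assms by blast
  let ?Q = "cycle_fiber f \<gamma> t0 // cycle_sign_rel"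
  have "(\<lambda>t. \<Prod>c\<in>?Q. cycle_quotient \<omega> (map_prod (\<lambda>a. g a t) (\<lambda>a. g a t) (SOME \<gamma>. \<gamma> \<in> c)))
      holomorphic_on ball t0 r"
    by (intro holomorphic_on_prod cycle_quotient_root_branches_holomorphic[OF rg] some_cycle_sign_class)
  then have "(\<lambda>t. cycle_product \<omega> (cycle_fiber f \<gamma> t)) holomorphic_on ball t0 r"
    by (rule holomorphic_transform) (rule cycle_product_root_branches[OF rg, symmetric])
  then have "(\<lambda>t. cycle_product \<omega> (cycle_fiber f \<gamma> t)) field_differentiable at t0"
    using root_branchesD(2)[OF rg] holomorphic_on_imp_differentiable_at by blast
  then show "(\<lambda>t. cycle_product \<omega> (cycle_fiber f \<gamma> t)) field_differentiable at t0 within - critical_values f"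
    by (rule field_differentiable_at_within)
qed

text \<open>The growth bound holds at every \<open>t\<close>, so \<open>R\<close> is bounded near
  each critical value and the singularities are removable. The extension has polynomial growth,
  hence is a polynomial.\<close>

lemma cycle_product_polynomial:
  assumes "degree f > 0"
  obtains p where "\<And>t. t \<notin> critical_values f \<Longrightarrow> poly p t = cycle_product \<omega> (cycle_fiber f \<gamma> t)"
    "2 * degree p \<le> (degree \<omega> - 1) * (degree f - 1)"
proof -
  define R where "R t = cycle_product \<omega> (cycle_fiber f \<gamma> t)" for t
  define m where "m = (degree \<omega> - 1) * (degree f - 1)"
  obtain C where C: "C \<ge> 0" "\<And>t. norm (R t) ^ 2 \<le> C * (1 + norm t) ^ m"
    using norm_cycle_product_le[OF assms] unfolding R_def m_def by metis
  have fin: "finite (critical_values f)" using finite_critical_values assms .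
  have R1: "norm (R t) \<le> (1 + C) * (1 + norm t) ^ m" for t
  proof -
    \<comment> \<open>This turns the bound on the square into one on \<open>R\<close>. The exponent
      \<open>m\<close> is twice too large, but it suffices for removability and for
      Liouville.\<close>
    have "0 \<le> (norm (R t) - 1) ^ 2" by simp
    then have "2 * norm (R t) \<le> 1 + norm (R t) ^ 2"
      by (simp add: power2_diff)
    then have "norm (R t) \<le> 1 + norm (R t) ^ 2"
      using norm_ge_zero[of "R t"] by linarith
    also have "\<dots> \<le> 1 * (1 + norm t) ^ m + C * (1 + norm t) ^ m"
      using C(2)[of t] by (intro add_mono) auto
    finally show ?thesis by (simp add: algebra_simps)
  qed
  have "\<exists>g. g holomorphic_on UNIV \<and> (\<forall>z\<in>UNIV - critical_values f. g z = R z)"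
  proof (rule removable_singularities[OF fin])
    show "R holomorphic_on UNIV - critical_values f"
      using cycle_product_holomorphic[OF assms, of \<omega> \<gamma>] by (simp add: R_def[abs_def] Compl_eq_Diff_UNIV)
    fix z :: complex
    have "eventually (\<lambda>t. t \<in> ball z 1) (at z)"
      by (rule eventually_at_in_open') auto
    then have "eventually (\<lambda>t. norm (R t) \<le> ((1 + C) * (2 + norm z) ^ m) * norm (1 :: complex)) (at z)"
    proof eventually_elim
      case (elim t)
      have "norm t \<le> norm z + norm (t - z)" by (metis add.commute diff_add_cancel norm_triangle_ineq)
      then have "1 + norm t \<le> 2 + norm z" using elim by (simp add: dist_norm norm_minus_commute)
      then have "(1 + C) * (1 + norm t) ^ m \<le> (1 + C) * (2 + norm z) ^ m"
        using C(1) by (intro mult_left_mono power_mono) auto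
      then show ?case using R1[of t] by simp
    qed
    then show "R \<in> O[at z](\<lambda>_. 1)" by (rule bigoI)
  qed auto
  then obtain g where g: "g holomorphic_on UNIV" "\<And>z. z \<notin> critical_values f \<Longrightarrow> g z = R z" by blast
  obtain A0 where A0: "\<And>z. z \<in> critical_values f \<Longrightarrow> norm z \<le> A0"
    using finite_imp_bounded[OF fin] unfolding bounded_iff by blast
  define A where "A = A0 + 1"
  have gR: "g z = R z" if "A \<le> norm z" for z
    using g(2)[of z] A0[of z] that by (fastforce simp: A_def)
  obtain p where p: "\<And>z. g z = poly p z"
    using entire_poly_of_growth[of g A "1 + C" m] g(1) gR R1 by metis
  \<comment> \<open>Returning to the bound on the square recovers the sharp degree.\<close>
  have "degree (p ^ 2) \<le> m"
  proof (rule degree_le_of_norm_poly_le)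
    fix t :: complex assume "A \<le> norm t"
    then show "norm (poly (p ^ 2) t) \<le> C * (1 + norm t) ^ m"
      using C(2)[of t] gR p by (simp add: norm_power poly_power)
  qed
  moreover have "degree (p ^ 2) = 2 * degree p"
    by (cases "p = 0") (auto simp: degree_power_eq)
  ultimately have "2 * degree p \<le> m" by simp
  with p g(2) show ?thesis using that unfolding R_def m_def by metis
qed

text \<open>Over a trivialising disc around \<open>b\<close>, continuation along segments follows
  the holomorphic branches, and the orbit is the fibre of the component over
  \<open>b\<close>.\<close>

lemma orbit_product_eq_cycle_product:
  assumes "degree f > 0" "b \<notin> critical_values f" "\<gamma> \<in> simple_cycles f b"
  shows "\<forall>\<^sub>F t in nhds b. orbit_product f b \<omega> (cycle_orbit f b \<gamma>) t = cycle_product \<omega> (cycle_fiber f \<gamma> t)"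
proof -
  obtain r g where rg: "root_branches f b r g" using root_branches_exist assms(1,2) by blast
  note D = root_branchesD[OF rg]
  have "\<forall>\<^sub>F t in nhds b. t \<in> ball b r"
    using D(2) by (intro eventually_nhds_in_open) auto
  then show ?thesis
  proof eventually_elim
    case (elim t)
    show ?case
      unfolding cycle_product_root_branches[OF rg elim] orbit_product_def
        cycle_orbit_eq_cycle_fiber[OF assms(1,3)]
    proof (rule prod.cong[OF refl])
      fix c assume "c \<in> cycle_fiber f \<gamma> b // cycle_sign_rel"
      then have "(SOME \<gamma>. \<gamma> \<in> c) \<in> simple_cycles f b" by (rule some_cycle_sign_class)
      then have "cycle_branch f b t (SOME \<gamma>. \<gamma> \<in> c) =
          map_prod (\<lambda>a. g a t) (\<lambda>a. g a t) (SOME \<gamma>. \<gamma> \<in> c)"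
        using root_branch_eq[OF assms(1) rg elim]
        by (cases "SOME \<gamma>. \<gamma> \<in> c") (auto simp: cycle_branch_def simple_cycles_def)
      then show "cycle_quotient \<omega> (cycle_branch f b t (SOME \<gamma>. \<gamma> \<in> c)) =
          cycle_quotient \<omega> (map_prod (\<lambda>a. g a t) (\<lambda>a. g a t) (SOME \<gamma>. \<gamma> \<in> c))" by simp
    qed
  qed
qed

section \<open>Propagation of identical vanishing along the curve\<close>

text \<open>Otherwise every factor has finitely many zeros on a smaller closed disc, and these
  finitely many finite sets would cover an open disc.\<close>

lemma holomorphic_prod_eq_zero:
  assumes "finite I" "r > 0" "\<And>i. i \<in> I \<Longrightarrow> h i holomorphic_on ball a r"
    and "\<And>z. z \<in> ball a r \<Longrightarrow> (\<Prod>i\<in>I. h i z) = 0"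
  obtains i where "i \<in> I" "\<And>z. z \<in> ball a r \<Longrightarrow> h i z = 0"
proof -
  let ?K = "cball a (r / 2)"
  have K: "?K \<subseteq> ball a r" using assms(2) by (auto simp: subset_iff)
  have "\<exists>i\<in>I. \<forall>z\<in>ball a r. h i z = 0"
  proof (rule ccontr)
    assume neg: "\<not> ?thesis"
    have "finite {z \<in> ?K. h i z = 0}" if "i \<in> I" for i
    proof (cases "h i constant_on ball a r")
      case True
      then have "{z \<in> ?K. h i z = 0} = {}"
        using neg that K unfolding constant_on_def by fastforce
      then show ?thesis by (metis finite.emptyI)
    next
      case False
      then show ?thesis
        using holomorphic_compact_finite_zeros[OF assms(3)[OF that] _ _ _ K] by simp
    qed
    moreover have "ball a (r / 2) \<subseteq> (\<Union>i\<in>I. {z \<in> ?K. h i z = 0})"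
    proof
      fix z assume z: "z \<in> ball a (r / 2)"
      then have "z \<in> ball a r" using assms(2) by simp
      then have "(\<Prod>i\<in>I. h i z) = 0" by (rule assms(4))
      then show "z \<in> (\<Union>i\<in>I. {z \<in> ?K. h i z = 0})" using z assms(1) by (auto simp: prod_zero_iff)
    qed
    ultimately have "finite (ball a (r / 2))"
      using assms(1) by (meson finite_UN finite_subset)
    then show False using finite_imp_not_open[of "ball a (r / 2)"] assms(2) by auto
  qed
  then show ?thesis using that by blast
qed

text \<open>Vanishing of the germ of the integral on the curve. Unlike vanishing at a point, this
  property spreads along a connected set.\<close>

definition integral_vanishes_near :: "complex poly \<Rightarrow> complex poly \<Rightarrow> cycle \<Rightarrow> bool" where
  "integral_vanishes_near f \<omega> \<delta> \<longleftrightarrow>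
     (\<exists>V. open V \<and> \<delta> \<in> V \<and> (\<forall>\<eta>\<in>V \<inter> root_pairs f. cycle_integral \<omega> \<eta> = 0))"

text \<open>The product of two sheets contains pairs with different parameters, but on the curve
  both coordinates have the same value under \<open>f\<close>, which forces a common
  parameter.\<close>

lemma root_branches_chart:
  assumes "root_branches f t0 r g" "(a, a') \<in> simple_cycles f t0"
  defines "V \<equiv> (g a ` ball t0 r) \<times> (g a' ` ball t0 r)"
  shows "open V" "(a, a') \<in> V"
    and "\<And>\<delta>. \<delta> \<in> V \<inter> root_pairs f \<Longrightarrow> \<exists>t\<in>ball t0 r. \<delta> = (g a t, g a' t)"
proof -
  note D = root_branchesD[OF assms(1)]
  have a: "a \<in> fiber f t0" "a' \<in> fiber f t0"
    using assms(2) by (auto simp: simple_cycles_def)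
  show "open V"
    unfolding V_def by (intro open_Times root_branches_open_image[OF assms(1)] a)
  show "(a, a') \<in> V"
    unfolding V_def using D(2) D(6)[OF a(1), symmetric] D(6)[OF a(2), symmetric] by blast
  fix \<delta> assume \<delta>: "\<delta> \<in> V \<inter> root_pairs f"
  then obtain s t where st: "s \<in> ball t0 r" "t \<in> ball t0 r" "\<delta> = (g a s, g a' t)"
    unfolding V_def by auto
  have "s = t"
    using \<delta> D(10)[OF st(1) a(1)] D(10)[OF st(2) a(2)] by (simp add: st(3) root_pairs_def)
  then show "\<exists>t\<in>ball t0 r. \<delta> = (g a t, g a' t)" using st by blast
qed

text \<open>Identity theorem on the disc: the integral vanishes at all parameters near
  \<open>s\<close>, hence at all parameters.\<close>

lemma integral_zero_of_vanishes_near: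
  assumes "root_branches f t0 r g" "(a, a') \<in> simple_cycles f t0"
    and "s \<in> ball t0 r" "integral_vanishes_near f \<omega> (g a s, g a' s)" "t \<in> ball t0 r"
  shows "cycle_integral \<omega> (g a t, g a' t) = 0"
proof -
  note D = root_branchesD[OF assms(1)]
  have a: "a \<in> fiber f t0" "a' \<in> fiber f t0" "a \<noteq> a'"
    using assms(2) by (auto simp: simple_cycles_def)
  obtain V where V: "open V" "(g a s, g a' s) \<in> V"
      "\<And>\<eta>. \<eta> \<in> V \<inter> root_pairs f \<Longrightarrow> cycle_integral \<omega> \<eta> = 0"
    using assms(4) unfolding integral_vanishes_near_def by blast
  let ?G = "\<lambda>t. (g a t, g a' t)"
  let ?U = "ball t0 r \<inter> ?G -` V"
  have "continuous_on (ball t0 r) ?G" by (intro continuous_on_Pair D(5) a)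
  then have "open ?U"
    using continuous_on_open_vimage[of "ball t0 r" ?G] V(1) by (simp add: Int_commute)
  moreover have "?U \<noteq> {}" using assms(3) V(2) by blast
  moreover have "(\<lambda>t. poly \<omega> (g c t)) holomorphic_on ball t0 r" if "c \<in> fiber f t0" for c
    using D(4)[OF that] by (intro holomorphic_intros)
  moreover have "poly \<omega> (g a z) = poly \<omega> (g a' z)" if z: "z \<in> ?U" for z
  proof -
    \<comment> \<open>A trivial path serves only to show that the pair lies on the curve.\<close>
    have "path_component (root_pairs f) (?G z) (?G z)"
      using path_component_root_branches[OF assms(1) a] z by blast
    then have "?G z \<in> root_pairs f" by (rule path_component_mem)
    then show ?thesis using V(3)[of "?G z"] z by (simp add: cycle_integral_def)
  qed
  ultimately have "poly \<omega> (g a t) = poly \<omega> (g a' t)"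
    using analytic_continuation_open[of ?U "ball t0 r" "\<lambda>t. poly \<omega> (g a t)" "\<lambda>t. poly \<omega> (g a' t)" t]
      a assms(5) by auto
  then show ?thesis by (simp add: cycle_integral_def)
qed

lemma integral_vanishes_near_chart:
  assumes "root_branches f t0 r g" "(a, a') \<in> simple_cycles f t0"
    and "\<And>t. t \<in> ball t0 r \<Longrightarrow> cycle_integral \<omega> (g a t, g a' t) = 0"
    and "\<delta> \<in> (g a ` ball t0 r) \<times> (g a' ` ball t0 r)"
  shows "integral_vanishes_near f \<omega> \<delta>"
  unfolding integral_vanishes_near_def
proof (intro exI conjI ballI)
  show "open ((g a ` ball t0 r) \<times> (g a' ` ball t0 r))"
    by (rule root_branches_chart(1)[OF assms(1,2)])
  fix \<eta> assume "\<eta> \<in> (g a ` ball t0 r) \<times> (g a' ` ball t0 r) \<inter> root_pairs f"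
  then obtain t where "t \<in> ball t0 r" "\<eta> = (g a t, g a' t)"
    using root_branches_chart(3)[OF assms(1,2)] by blast
  then show "cycle_integral \<omega> \<eta> = 0" using assms(3) by simp
qed (fact assms(4))

text \<open>Analytic continuation as an induction over a connected set: within one chart, vanishing
  near one point passes to vanishing near every other.\<close>

lemma integral_vanishes_on_component:
  assumes "degree f > 0" "integral_vanishes_near f \<omega> \<delta>" "path_component (root_pairs f) \<delta> \<eta>"
  shows "cycle_integral \<omega> \<eta> = 0"
proof -
  let ?K = "path_component_set (root_pairs f) \<delta>"
  have "connected ?K" by (simp add: path_connected_imp_connected)
  moreover have "\<delta> \<in> ?K" "\<eta> \<in> ?K"
    using assms(3) path_component_mem(1)[OF assms(3)] path_component_refl by auto
  ultimately have "integral_vanishes_near f \<omega> \<eta>"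
    using assms(2)
  proof (rule connected_induction_simple)
    fix \<alpha> assume "\<alpha> \<in> ?K"
    then have "\<alpha> \<in> root_pairs f" using path_component_mem(2) by blast
    then obtain a a' t0 where a: "\<alpha> = (a, a')" "(a, a') \<in> simple_cycles f t0" "t0 \<notin> critical_values f"
      by (auto simp: root_pairs_def simple_cycles_def fiber_def)
    obtain r g where rg: "root_branches f t0 r g" using root_branches_exist assms(1) a(3) by blast
    let ?V = "(g a ` ball t0 r) \<times> (g a' ` ball t0 r)"
    note V = root_branches_chart[OF rg a(2)]
    have *: "integral_vanishes_near f \<omega> y"
      if xy: "x \<in> ?K \<inter> ?V" "y \<in> ?K \<inter> ?V" "integral_vanishes_near f \<omega> x" for x y
    proof -
      have "x \<in> root_pairs f" using xy(1) path_component_mem(2) by blast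
      then obtain s where s: "s \<in> ball t0 r" "x = (g a s, g a' s)"
        using V(3)[of x] xy(1) by blast
      have "cycle_integral \<omega> (g a t, g a' t) = 0" if "t \<in> ball t0 r" for t
        using integral_zero_of_vanishes_near[OF rg a(2) s(1) _ that] xy(3) s(2) by simp
      then show ?thesis
        using integral_vanishes_near_chart[OF rg a(2)] xy(2) by blast
    qed
    show "\<exists>T. openin (top_of_set ?K) T \<and> \<alpha> \<in> T \<and>
        (\<forall>x\<in>T. \<forall>y\<in>T. integral_vanishes_near f \<omega> x \<longrightarrow> integral_vanishes_near f \<omega> y)"
    proof (intro exI[of _ "?K \<inter> ?V"] conjI ballI impI)
      show "openin (top_of_set ?K) (?K \<inter> ?V)" using V(1) by (rule openin_open_Int)
      show "\<alpha> \<in> ?K \<inter> ?V" using V(2) \<open>\<alpha> \<in> ?K\<close> a(1) by blast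
    qed (rule *)
  qed
  then show ?thesis
    using path_component_mem(2)[OF assms(3)] unfolding integral_vanishes_near_def by blast
qed

text \<open>One factor vanishes identically on a disc around \<open>b\<close>. Its cycle lies in the
  component of \<gamma> up to sign, and from there the vanishing reaches the whole
  component.\<close>

lemma integral_vanishes_of_cycle_product_zero:
  assumes "degree f > 0" "b \<notin> critical_values f"
    and "\<And>t. t \<notin> critical_values f \<Longrightarrow> cycle_product \<omega> (cycle_fiber f \<gamma> t) = 0"
    and "path_component (root_pairs f) \<gamma> \<eta>"
  shows "cycle_integral \<omega> \<eta> = 0"
proof -
  obtain r g where rg: "root_branches f b r g" using root_branches_exist assms(1,2) by blast
  note D = root_branchesD[OF rg]
  let ?Q = "cycle_fiber f \<gamma> b // cycle_sign_rel"
  let ?h = "\<lambda>c t. cycle_quotient \<omega> (map_prod (\<lambda>a. g a t) (\<lambda>a. g a t) (SOME \<gamma>. \<gamma> \<in> c))"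
  obtain c where c: "c \<in> ?Q" "\<And>t. t \<in> ball b r \<Longrightarrow> ?h c t = 0"
  proof (rule holomorphic_prod_eq_zero[OF finite_cycle_classes[OF assms(1)] D(1)])
    show "?h c holomorphic_on ball b r" if "c \<in> ?Q" for c
      using that by (intro cycle_quotient_root_branches_holomorphic[OF rg] some_cycle_sign_class)
    show "(\<Prod>c\<in>?Q. ?h c t) = 0" if "t \<in> ball b r" for t
      using cycle_product_root_branches[OF rg that, of \<omega> \<gamma>] assms(3)[of t] that D(3) by auto
  qed blast
  obtain \<delta> where \<delta>: "\<delta> \<in> cycle_fiber f \<gamma> b" "c = {\<delta>, prod.swap \<delta>}"
    using c(1) by (rule cycle_sign_quotientE)
  have "\<delta> \<in> simple_cycles f b" using \<delta>(1) cycle_fiber_subset by blast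
  then obtain a a' where a: "\<delta> = (a, a')" "(a, a') \<in> simple_cycles f b" "a \<in> fiber f b" "a' \<in> fiber f b" "a \<noteq> a'"
    by (auto simp: simple_cycles_def)
  have "cycle_integral \<omega> (g a t, g a' t) = 0" if t: "t \<in> ball b r" for t
  proof -
    let ?\<phi> = "map_prod (\<lambda>a. g a t) (\<lambda>a. g a t)"
    have "cycle_quotient \<omega> (?\<phi> (prod.swap \<gamma>)) = cycle_quotient \<omega> (?\<phi> \<gamma>)" for \<gamma>
      using cycle_quotient_swap[of \<omega> "?\<phi> \<gamma>"] by (cases \<gamma>) simp
    then have "cycle_quotient \<omega> (?\<phi> \<delta>) = 0"
      using c(2)[OF t] swap_invariant_some[of "\<lambda>\<gamma>. cycle_quotient \<omega> (?\<phi> \<gamma>)" \<delta>] by (simp only: \<delta>(2))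
    then show ?thesis
      using inj_on_contraD[OF D(8)[OF t] a(5,3,4)]
      by (auto simp: a(1) cycle_quotient_def cycle_integral_def)
  qed
  then have "integral_vanishes_near f \<omega> \<delta>"
    using integral_vanishes_near_chart[OF rg a(2)] root_branches_chart(2)[OF rg a(2)] a(1) by blast
  moreover have "path_component (root_pairs f) \<delta> \<eta>"
    using \<delta>(1) assms(4) path_component_sym path_component_trans unfolding cycle_fiber_def by blast
  ultimately show ?thesis using integral_vanishes_on_component[OF assms(1)] by blast
qed

section \<open>Counting the zeros of the integral along a family\<close>

theorem theorem3:
  fixes f \<omega> :: "complex poly" and d n :: nat and b :: complex
    and D :: "complex set" and S\<^sub>i :: "cycle set" and \<gamma> :: "complex \<Rightarrow> cycle"
  assumes "degree f = d"
    and "b \<notin> critical_values f"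
    and "S\<^sub>i \<in> cycle_orbits f b"
    and "degree \<omega> = n"
    and "simply_connected D" and "D \<subseteq> - critical_values f" and "b \<in> D"
    and "simple_cycle_family f D \<gamma>"
    and "\<gamma> b \<in> S\<^sub>i"
    and "\<not> (\<forall>t\<in>D. cycle_integral \<omega> (\<gamma> t) = 0)"
  shows "finite {t \<in> D. cycle_integral \<omega> (\<gamma> t) = 0} \<and>
    card {t \<in> D. cycle_integral \<omega> (\<gamma> t) = 0} \<le> degree (orbit_poly f b \<omega> S\<^sub>i) \<and>
    real (degree (orbit_poly f b \<omega> S\<^sub>i)) \<le> (real n - 1) * (real d - 1) / 2"
proof -
  obtain \<gamma>\<^sub>0 where \<gamma>\<^sub>0: "\<gamma>\<^sub>0 \<in> simple_cycles f b" "S\<^sub>i = cycle_orbit f b \<gamma>\<^sub>0"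
    using assms(3) by (auto simp: cycle_orbits_def)
  have f: "degree f > 0"
  proof (rule ccontr)
    \<comment> \<open>A constant \<open>f\<close> with a root over \<open>b\<close> equals
      \<open>b\<close>, and then \<open>b\<close> is a critical value.\<close>
    assume "\<not> degree f > 0"
    then obtain c where "f = [:c:]" using degree_eq_zeroE by blast
    then show False using \<gamma>\<^sub>0(1) assms(2) by (auto simp: simple_cycles_def fiber_def critical_values_def)
  qed
  obtain p where p: "\<And>t. t \<notin> critical_values f \<Longrightarrow> poly p t = cycle_product \<omega> (cycle_fiber f \<gamma>\<^sub>0 t)"
      "2 * degree p \<le> (degree \<omega> - 1) * (degree f - 1)"
    using cycle_product_polynomial[OF f] by metis
  have "\<forall>\<^sub>F t in nhds b. t \<in> - critical_values f"
    using assms(2) open_regular_values[OF f] by (intro eventually_nhds_in_open) auto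
  with orbit_product_eq_cycle_product[OF f assms(2) \<gamma>\<^sub>0(1), of \<omega>]
  have "\<forall>\<^sub>F t in nhds b. poly p t = orbit_product f b \<omega> S\<^sub>i t"
    by eventually_elim (simp add: p(1) \<gamma>\<^sub>0(2))
  then have orbit_poly: "orbit_poly f b \<omega> S\<^sub>i = p" by (rule orbit_poly_eqI)

  have cont: "continuous_on D \<gamma>"
    using assms(8) continuous_on_Pair[of D "\<lambda>t. fst (\<gamma> t)" "\<lambda>t. snd (\<gamma> t)"]
    by (simp add: simple_cycle_family_def)
  have cycles: "\<gamma> t \<in> simple_cycles f t" if "t \<in> D" for t
    using assms(8) that by (simp add: simple_cycle_family_def)
  have "\<gamma> ` D \<subseteq> root_pairs f"
    using cycles assms(6) by (fastforce simp: simple_cycles_def fiber_def root_pairs_def)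
  moreover have "path_connected (\<gamma> ` D)"
    using cont assms(5) simply_connected_imp_path_connected path_connected_continuous_image by blast
  \<comment> \<open>The family sweeps out a path-connected part of the curve, so it stays in the
    component fixed by the orbit at \<open>b\<close>.\<close>
  ultimately have "path_component (root_pairs f) (\<gamma> b) (\<gamma> t)" if "t \<in> D" for t
    using assms(7) that path_component_of_subset unfolding path_connected_component by blast
  moreover have "path_component (root_pairs f) \<gamma>\<^sub>0 (\<gamma> b)"
    using assms(9) unfolding \<gamma>\<^sub>0(2) cycle_orbit_eq_cycle_fiber[OF f \<gamma>\<^sub>0(1)] cycle_fiber_def by simp
  ultimately have comp: "path_component (root_pairs f) \<gamma>\<^sub>0 (\<gamma> t)" if "t \<in> D" for t
    using that path_component_trans by blast

  have "p \<noteq> 0"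
  proof
    assume "p = 0"
    then have "cycle_integral \<omega> (\<gamma> t) = 0" if "t \<in> D" for t
      using integral_vanishes_of_cycle_product_zero[OF f assms(2) _ comp[OF that], of \<omega>] p(1) by simp
    with assms(10) show False by blast
  qed
  have zeros: "{t \<in> D. cycle_integral \<omega> (\<gamma> t) = 0} \<subseteq> {t. poly p t = 0}"
  proof clarify
    fix t assume t: "t \<in> D" "cycle_integral \<omega> (\<gamma> t) = 0"
    let ?Q = "cycle_fiber f \<gamma>\<^sub>0 t // cycle_sign_rel"
    have "fst (\<gamma> t) \<in> fiber f t" using cycles[OF t(1)] by (auto simp: simple_cycles_def)
    \<comment> \<open>The cycle of the family at \<open>t\<close> is, up to sign, one of those
      indexing the product, so its zero quotient annihilates the product.\<close>
    then have "{\<gamma> t, prod.swap (\<gamma> t)} \<in> ?Q"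
      using comp[OF t(1)] by (intro cycle_sign_quotientI) (simp add: cycle_fiber_def)
    moreover have "cycle_quotient \<omega> (SOME \<delta>. \<delta> \<in> {\<gamma> t, prod.swap (\<gamma> t)}) = 0"
      unfolding swap_invariant_some[of "cycle_quotient \<omega>", OF cycle_quotient_swap]
      by (simp add: cycle_quotient_def t(2))
    ultimately have "cycle_product \<omega> (cycle_fiber f \<gamma>\<^sub>0 t) = 0"
      unfolding cycle_product_def by (intro prod_zero[OF finite_cycle_classes[OF f]] bexI)
    then show "poly p t = 0" using p(1) t(1) assms(6) by auto
  qed
  have fin: "finite {t. poly p t = 0}" using \<open>p \<noteq> 0\<close> by (rule poly_roots_finite)
  have "card {t \<in> D. cycle_integral \<omega> (\<gamma> t) = 0} \<le> card {t. poly p t = 0}"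
    using card_mono[OF fin zeros] .
  also have "\<dots> \<le> degree p" using \<open>p \<noteq> 0\<close> by (rule card_poly_roots_bound)
  finally have card: "card {t \<in> D. cycle_integral \<omega> (\<gamma> t) = 0} \<le> degree p" .

  \<comment> \<open>For \<open>n = 0\<close> the truncated \<open>n - 1\<close> would differ from
    the real one; but a constant \<omega> has zero integral, which is excluded.\<close>
  have "n > 0"
  proof (rule ccontr)
    assume "\<not> n > 0"
    then obtain c where "\<omega> = [:c:]" using assms(4) degree_eq_zeroE by blast
    with assms(10) show False by (simp add: cycle_integral_def)
  qed
  have "real (2 * degree p) \<le> real ((n - 1) * (d - 1))"
    using p(2) assms(1,4) of_nat_le_iff by blast
  also have "\<dots> = (real n - 1) * (real d - 1)"
    using \<open>n > 0\<close> f assms(1) by (simp add: of_nat_diff)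
  finally have "real (degree p) \<le> (real n - 1) * (real d - 1) / 2" by simp
  then show ?thesis
    unfolding orbit_poly using finite_subset[OF zeros fin] card by blast
qed

end
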